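(* For each positive integer $j$, let $n_j$ be the number of SP numbers strictly less than $j$, and let $U_j=\left\{\frac{sp_1}{j},\frac{sp_2}{j},\dots,\frac{sp_{n_j}}{j}\right\}$, where $sp_1<sp_2<\cdots$ are the SP numbers in increasing order (starting with $sp_1=8$). Then the sequence of finite sequences $U=\{U_1,U_2,U_3,\dots\}$ is uniformly distributed, that is, for all real $\alpha,\beta$ with $0\le\alpha\le\beta\le 1$, $$\lim_{j\to\infty}\frac{\#\{u\in U_j : u\in(\alpha,\beta)\}}{\# U_j}=\beta-\alpha .$$
   Context: An SP number (square-prime number) is a positive integer of the form $p\cdot a^2$ with $p$ prime and $a\ge 2$ an integer. The first few are $8,12,18,20,27,28,32,44,45,48,50,\dots$. For a sequence $U=\{U_1,U_2,\dots\}$ of finite sequences of numbers between $0$ and $1$, "uniformly distributed" means that for all $0\le\alpha\le\beta\le1$ the proportion of terms of $U_j$ lying in $(\alpha,\beta)$ tends to $\beta-\alpha$ as $j\to\infty$. The sets $U_j$ are empty for $j\le 8$, which does not affect the limit. *)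

theory Defs
  imports Complex_Main "HOL-Library.Infinite_Set" "HOL-Computational_Algebra.Primes"
begin

definition SP_number :: "nat \<Rightarrow> bool" where
  "SP_number m \<longleftrightarrow> (\<exists>p a. prime p \<and> a \<ge> 2 \<and> m = p * a\<^sup>2)"

text \<open>The SP numbers in increasing order, indexed from 0, so that \<open>sp 0\<close> is the first one, 8.
  (The library function \<open>enumerate\<close> lists an infinite set of naturals in increasing order.)\<close>

definition sp :: "nat \<Rightarrow> nat" where
  "sp k = enumerate {m. SP_number m} k"

definition SP_count :: "nat \<Rightarrow> nat" where
  "SP_count j = card {m. SP_number m \<and> m < j}"

text \<open>Finite sequences are lists, so terms are counted with multiplicity. For an empty list the
  proportion below is \<open>0 / 0 = 0\<close>; only finitely many \<open>SP_fractions j\<close> are empty, so this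
  convention does not affect the limit. The same applies to the value at \<open>j = 0\<close>.\<close>

definition SP_fractions :: "nat \<Rightarrow> real list" where
  "SP_fractions j = map (\<lambda>k. real (sp k) / real j) [0..<SP_count j]"

definition uniformly_distributed :: "(nat \<Rightarrow> real list) \<Rightarrow> bool" where
  "uniformly_distributed U \<longleftrightarrow>
     (\<forall>\<alpha> \<beta>. 0 \<le> \<alpha> \<and> \<alpha> \<le> \<beta> \<and> \<beta> \<le> 1 \<longrightarrow>
       (\<lambda>j. real (length (filter (\<lambda>u. u \<in> {\<alpha><..<\<beta>}) (U j))) / real (length (U j)))
         \<longlonglongrightarrow> \<beta> - \<alpha>)"

end

theory Submission
  imports Defs "HOL-Complex_Analysis.Complex_Analysis" "HOL-Number_Theory.Prime_Powers"
    "HOL-Real_Asymp.Real_Asymp"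
begin

text \<open>The SP numbers in \<open>(\<alpha> * j, \<beta> * j)\<close> are counted by a difference of values of the counting function
  \<open>SP_below\<close>, so uniform distribution says that this function is regularly varying of index 1: its values
  at \<open>c * x\<close> and at \<open>x\<close> have a ratio that tends to \<open>c\<close> (\<open>SP_below_ratio\<close>). A number \<open>p * a^2\<close>
  determines \<open>p\<close> and \<open>a\<close>, so the counting function at \<open>x\<close> is the sum of \<open>prime_count (x / a^2)\<close> over
  \<open>a \<ge> 2\<close> (\<open>card_SP_below\<close>). By the prime number theorem the term for \<open>a\<close> is asymptotic to
  \<open>(1 / a^2) * x / ln x\<close>. Tannery's theorem allows summing these asymptotics, so the counting function is
  asymptotic to \<open>\<kappa> * x / ln x\<close> with \<open>\<kappa> > 0\<close> (\<open>SP_below_asymptotics\<close>), which is regularly varying.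

  The main work is the prime number theorem, which is proved by Newman's method. The function
  \<open>zeta_reg\<close>, which is \<open>(s - 1) * zeta s\<close>, is holomorphic for \<open>Re s > 0\<close> and has no zero with
  \<open>Re s \<ge> 1\<close> (\<open>zeta_reg_nonzero\<close>), by the classical inequality for \<open>3 + 4 * cos \<theta> + cos (2 * \<theta>)\<close>. Hence
  the Dirichlet series of \<open>mangoldt n - 1\<close>, which is \<open>- zeta' / zeta - zeta\<close>, extends across the line
  \<open>Re s = 1\<close>. By summation by parts so does the Dirichlet series of \<open>(chebyshev_psi n - n) / n\<close>, whose
  coefficients are bounded by an elementary estimate of Chebyshev. Newman's Tauberian theorem (\<open>newman\<close>)
  turns this into convergence of the sum of \<open>(chebyshev_psi n - n) / n^2\<close>. As \<open>chebyshev_psi\<close> is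
  monotone, that is possible only if \<open>chebyshev_psi n / n\<close> tends to 1 (\<open>psi_asymptotics\<close>). Comparison of
  \<open>chebyshev_psi\<close> with the number of primes completes the argument.\<close>

section \<open>Newman's Tauberian theorem\<close>

text \<open>Comparing a power with its integral over a unit interval, in the form of the mean value theorem.
  The telescoping right-hand side gives \<open>N powr (-x) / x\<close> as a bound for the tail of a series whose
  terms are \<open>n powr (-1 - x)\<close>. The factor \<open>1/x\<close> is harmless in Newman's contour argument, because
  there the kernel vanishes like \<open>x\<close> near the imaginary axis.\<close>
lemma powr_le_telescope_neg:
  fixes x t :: real
  assumes "x > 0" "t > 0"
  shows "(t + 1) powr (-1 - x) \<le> (t powr (-x) - (t + 1) powr (-x)) / x"
proof -
  have "\<exists>z. z > t \<and> z < t + 1 \<and>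
     (- ((t+1) powr (-x)) / x) - (- (t powr (-x)) / x) = (t + 1 - t) * (z powr (-1 - x))"
  proof (rule MVT2)
    fix u assume "t \<le> u" "u \<le> t + 1"
    then show "((\<lambda>u. - (u powr (-x)) / x) has_real_derivative u powr (-1 - x)) (at u)"
      using assms by (auto intro!: derivative_eq_intros simp: field_simps powr_diff powr_minus)
  qed simp
  then obtain z where z: "z > t" "z < t + 1"
    and eq: "(- ((t+1) powr (-x)) / x) - (- (t powr (-x)) / x) = z powr (-1 - x)" by auto
  have "(t + 1) powr (-1 - x) \<le> z powr (-1 - x)"
    using z assms by (intro powr_mono2') auto
  also have "\<dots> = (t powr (-x) - (t + 1) powr (-x)) / x"
    using eq assms by (simp add: field_simps)
  finally show ?thesis .
qed

lemma suminf_powr_tail_le: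
  fixes x :: real
  assumes "x > 0" "N > 0"
  shows "summable (\<lambda>n. real (Suc (n + N)) powr (-1 - x))"
    and "(\<Sum>n. real (Suc (n + N)) powr (-1 - x)) \<le> real N powr (-x) / x"
proof -
  define b where "b n = - (real (n + N) powr (-x)) / x" for n
  have lim: "b \<longlonglongrightarrow> - 0 / x"
    unfolding b_def
    by (intro tendsto_intros tendsto_neg_powr filterlim_compose[OF filterlim_real_sequentially]
        filterlim_add_const_nat_at_top) (use assms in auto)
  have tele: "(\<lambda>n. b (Suc n) - b n) sums (- 0 / x - b 0)"
    by (rule telescope_sums[OF lim])
  have le: "real (Suc (n + N)) powr (-1 - x) \<le> b (Suc n) - b n" for n
    using powr_le_telescope_neg[of x "real (n + N)"] assms by (simp add: b_def field_simps)
  show *: "summable (\<lambda>n. real (Suc (n + N)) powr (-1 - x))"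
    by (rule summable_comparison_test_ev[OF _ sums_summable[OF tele]]) (use le in auto)
  have "(\<Sum>n. real (Suc (n + N)) powr (-1 - x)) \<le> (\<Sum>n. b (Suc n) - b n)"
    by (intro suminf_le le * sums_summable[OF tele])
  also have "\<dots> = real N powr (-x) / x"
    using sums_unique[OF tele] by (simp add: b_def)
  finally show "(\<Sum>n. real (Suc (n + N)) powr (-1 - x)) \<le> real N powr (-x) / x" .
qed

lemma powr_MVT:
  fixes x t :: real
  assumes "x > 0" "t > 0"
  obtains z where "z > t" "z < t + 1" "((t+1) powr x - t powr x) / x = z powr (x - 1)"
proof -
  have "\<exists>z. z > t \<and> z < t + 1 \<and>
     ((t+1) powr x / x) - (t powr x / x) = (t + 1 - t) * (z powr (x - 1))"
  proof (rule MVT2)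
    fix u assume "t \<le> u" "u \<le> t + 1"
    then show "((\<lambda>u. u powr x / x) has_real_derivative u powr (x - 1)) (at u)"
      using assms by (auto intro!: derivative_eq_intros simp: field_simps powr_diff)
  qed simp
  then show thesis using that by (auto simp: diff_divide_distrib)
qed

text \<open>The exponent \<open>x - 1\<close> changes sign at \<open>x = 1\<close>. For \<open>x \<le> 1\<close> the sum lies below the integral from
  \<open>0\<close> to \<open>N\<close>. For \<open>x > 1\<close> only the sum without its last term does, and the second summand on the
  right pays for that term.\<close>
lemma sum_powr_le:
  fixes x :: real
  assumes "x > 0" "N > 0"
  shows "(\<Sum>n<N. real (Suc n) powr (x - 1)) \<le> real N powr x / x + real N powr (x - 1)"
proof (cases "x \<le> 1")
  case True
  have "(\<Sum>n<N. real (Suc n) powr (x - 1)) \<le> real N powr x / x"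
  proof (induction N)
    case (Suc N)
    have "real (Suc N) powr (x - 1) \<le> (real (Suc N) powr x - real N powr x) / x"
    proof (cases "N = 0")
      case False
      then obtain z where "z > real N" "z < real N + 1"
        "((real N+1) powr x - real N powr x) / x = z powr (x - 1)"
        using powr_MVT[of x "real N"] assms by auto
      moreover have "(real N + 1) powr (x - 1) \<le> z powr (x - 1)"
        using calculation True False by (intro powr_mono2') auto
      ultimately show ?thesis by (simp add: add.commute)
    qed (use True assms in auto)
    then show ?case using Suc by (simp add: diff_divide_distrib add.commute)
  qed auto
  then show ?thesis by (simp add: add_increasing2)
next
  case False
  obtain M where M: "N = Suc M" using assms by (cases N) auto
  have "(\<Sum>n<M. real (Suc n) powr (x - 1)) \<le> real (Suc M) powr x / x"
  proof (induction M)
    case (Suc M)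
    obtain z where "z > real (Suc M)" "z < real (Suc M) + 1"
        "((real (Suc M)+1) powr x - real (Suc M) powr x) / x = z powr (x - 1)"
      using powr_MVT[of x "real (Suc M)"] assms by auto
    moreover have "(real (Suc M)) powr (x - 1) \<le> z powr (x - 1)"
      using calculation False by (intro powr_mono2) auto
    ultimately show ?case using Suc by (simp add: diff_divide_distrib add.commute)
  qed (use assms in auto)
  then show ?thesis by (simp add: M)
qed

lemma part_circlepath_inverse:
  assumes "R > 0" "a \<le> b"
  shows "((\<lambda>z. 1 / z) has_contour_integral \<i> * of_real (b - a)) (part_circlepath 0 R a b)"
proof -
  have "0 \<notin> path_image (part_circlepath 0 R a b)"
    using assms path_image_part_circlepath_subset'[of R 0 a b] by auto
  then have "(\<lambda>z. 1 / z) contour_integrable_on part_circlepath 0 R a b"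
    by (intro contour_integrable_continuous_part_circlepath continuous_intros) auto
  moreover have "contour_integral (part_circlepath 0 R a b) (\<lambda>z. 1 / z) = \<i> * of_real (b - a)"
  proof (cases "a = b")
    case False
    then have "contour_integral (part_circlepath 0 R a b) (\<lambda>z. 1 / z) =
       integral {a..b} (\<lambda>t. (1 / (0 + R * cis t)) * R * \<i> * cis t)"
      using assms by (intro contour_integral_part_circlepath_eq) auto
    also have "\<dots> = integral {a..b} (\<lambda>t. \<i>)"
      using assms by (intro integral_cong) auto
    finally show ?thesis using assms by (simp add: scaleR_conv_of_real mult.commute)
  qed (simp add: part_circlepath_def contour_integral_integral vector_derivative_part_circlepath)
  ultimately show ?thesis using has_contour_integral_integral by metis
qed

text \<open>Newman's contour estimate. Let \<open>S\<close> be the \<open>N\<close>-th partial sum of the Dirichlet series, an entire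
  function, and integrate against the kernel \<open>N powr z * (1/z + z/R^2)\<close> over the circle \<open>|z| = R\<close>. The
  kernel has residue 1 at 0, and on the circle it equals \<open>N powr z * 2 * Re z / R^2\<close>. This balances the
  remainder \<open>F - S\<close>, of size \<open>C * N powr (-x) / x\<close> at \<open>Re z = x > 0\<close>, on the right semicircle, and \<open>S\<close>
  itself, of size about \<open>C * N powr x / x\<close> at \<open>Re z = -x < 0\<close>, on the left one. Each semicircle
  therefore contributes only \<open>O(C/R)\<close>, apart from terms that vanish as \<open>N\<close> grows.

  Since \<open>F\<close> is known only near the closed right half plane, its integral is not continued along the
  left semicircle. Instead \<open>F z = F 0 + z * G z\<close>: the constant \<open>F 0\<close> is entire, and for the regular
  part \<open>G z * N powr z * (1 + z^2/R^2)\<close> the right semicircle may be replaced by the segment between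
  its end points on the imaginary axis. There \<open>N powr z\<close> has modulus 1 and oscillates, so that one
  integration by parts gains a factor \<open>1 / ln N\<close>, as in the Riemann-Lebesgue lemma.\<close>
lemma newman_bound:
  fixes c :: "nat \<Rightarrow> complex" and F :: "complex \<Rightarrow> complex"
  assumes c: "\<And>n. norm (c n) \<le> C"
    and hol: "F holomorphic_on U" "open U" "{z. Re z \<ge> 0} \<subseteq> U"
    and sums: "\<And>z. Re z > 0 \<Longrightarrow> (\<lambda>n. c n * of_nat (Suc n) powr (-1 - z)) sums F z"
    and R: "R > 0"
  obtains M where "\<And>N. N \<ge> 2 \<Longrightarrow>
     norm (F 0 - (\<Sum>n<N. c n / of_nat (Suc n))) \<le> 2 * C / R + C / N + M / ln N"
proof -
  have C: "C \<ge> 0" using c[of 0] norm_ge_zero order_trans by blast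
  define Cp where "Cp = part_circlepath 0 R (-(pi/2)) (pi/2)"
  define Cm where "Cm = part_circlepath 0 R (pi/2) (3*pi/2)"
  define sg where "sg = linepath (\<i> * of_real R) (-(\<i> * of_real R))"
  have valid [simp]: "valid_path Cp" "valid_path Cm" "valid_path sg"
    by (simp_all add: Cp_def Cm_def sg_def)
  have exps: "exp (- (\<i> * of_real pi / 2)) = -\<i>" "exp (\<i> * of_real pi / 2) = \<i>"
    "exp (\<i> * (of_real pi * 3) / 2) = -\<i>"
  proof -
    have "cis (pi * 3 / 2) = -\<i>"
      using cos_3over2_pi sin_3over2_pi by (simp add: complex_eq_iff mult.commute)
    moreover have "cis (pi / 2) = \<i>" "cis (-(pi / 2)) = -\<i>"
      by (simp_all add: complex_eq_iff)
    ultimately show "exp (- (\<i> * of_real pi / 2)) = -\<i>" "exp (\<i> * of_real pi / 2) = \<i>"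
      "exp (\<i> * (of_real pi * 3) / 2) = -\<i>"
      by (simp_all add: cis_conv_exp)
  qed
  have ends [simp]: "pathstart Cp = -(\<i> * of_real R)" "pathfinish Cp = \<i> * of_real R"
    "pathstart Cm = \<i> * of_real R" "pathfinish Cm = -(\<i> * of_real R)"
    "pathstart sg = \<i> * of_real R" "pathfinish sg = -(\<i> * of_real R)"
    by (simp_all add: Cp_def Cm_def sg_def exps mult.commute)
  have Cp: "norm z = R \<and> Re z \<ge> 0" if "z \<in> path_image Cp" for z
    using that R unfolding Cp_def path_image_part_circlepath'
    by (auto simp: closed_segment_eq_real_ivl norm_mult intro!: mult_nonneg_nonneg cos_ge_zero)
  have Cm: "norm z = R \<and> Re z \<le> 0" if z: "z \<in> path_image Cm" for z
  proof -
    have "z \<in> (\<lambda>x. 0 + R * cis x) ` {pi/2..3*pi/2}"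
      using z unfolding Cm_def path_image_part_circlepath' by (simp add: closed_segment_eq_real_ivl)
    then obtain t where "z = 0 + R * cis t" "t \<in> {pi/2..3*pi/2}" by blast
    then have t: "z = R * cis t" "pi/2 \<le> t" "t \<le> 3*pi/2" by auto
    have "cos (t - pi) \<ge> 0" using t by (intro cos_ge_zero) auto
    then show ?thesis using t R by (auto simp: norm_mult mult_nonneg_nonpos cos_diff)
  qed
  have sg: "Re z = 0 \<and> norm z \<le> R" if z: "z \<in> path_image sg" for z
  proof -
    obtain u where "0 \<le> u" "u \<le> 1" "z = (1 - u) *\<^sub>R (\<i> * of_real R) + u *\<^sub>R (-(\<i> * of_real R))"
      using z unfolding sg_def by (auto simp: closed_segment_def)
    then have "z = \<i> * of_real (R * (1 - 2 * u))" by (simp add: scaleR_conv_of_real algebra_simps)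
    moreover have "\<bar>R * (1 - 2 * u)\<bar> \<le> R"
      using \<open>0 \<le> u\<close> \<open>u \<le> 1\<close> R by (simp add: abs_mult)
    ultimately show ?thesis by (simp add: norm_mult del: of_real_mult)
  qed
  have nz: "z \<noteq> 0" if "z \<in> path_image Cp \<union> path_image Cm" for z
    using that Cp[of z] Cm[of z] R by auto
  have intinv: "((\<lambda>z. 1 / z) has_contour_integral \<i> * pi) Cp" "((\<lambda>z. 1 / z) has_contour_integral \<i> * pi) Cm"
    using part_circlepath_inverse[of R "-(pi/2)" "pi/2"] part_circlepath_inverse[of R "pi/2" "3*pi/2"] R
    by (simp_all add: Cp_def Cm_def)

  \<comment> \<open>The residue theorem at 0 for an entire numerator, by the primitive case and \<open>1/z\<close>, which contributes \<open>\<i> * pi\<close> on each semicircle.\<close>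
  have split: "contour_integral Cp (\<lambda>z. h z / z) + contour_integral Cm (\<lambda>z. h z / z) = 2 * pi * \<i> * h 0"
    (is "?A + ?B = _") and
    intble: "(\<lambda>z. h z / z) contour_integrable_on Cp" "(\<lambda>z. h z / z) contour_integrable_on Cm"
    if h: "h holomorphic_on UNIV" for h :: "complex \<Rightarrow> complex"
  proof -
    have conth: "continuous_on A h" for A
      using h holomorphic_on_imp_continuous_on holomorphic_on_subset by blast
    show int: "(\<lambda>z. h z / z) contour_integrable_on Cp" "(\<lambda>z. h z / z) contour_integrable_on Cm"
      unfolding Cp_def Cm_def using nz
      by (auto intro!: contour_integrable_continuous_part_circlepath continuous_intros conth simp: Cp_def Cm_def)
    define k where "k z = (if z = 0 then deriv h 0 else (h z - h 0) / (z - 0))" for z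
    have k: "k holomorphic_on UNIV"
      unfolding k_def by (intro pole_lemma_open h open_UNIV)
    have "(k has_contour_integral 0) (Cp +++ Cm)"
      by (rule Cauchy_theorem_convex_simple[OF k]) (simp_all add: valid_path_join)
    then have "contour_integral (Cp +++ Cm) k = 0" by (rule contour_integral_unique)
    moreover have ki: "k contour_integrable_on Cp" "k contour_integrable_on Cm"
      by (rule contour_integrable_holomorphic_simple[OF k]; simp)+
    ultimately have 0: "contour_integral Cp k + contour_integral Cm k = 0"
      by simp
    have *: "contour_integral g (\<lambda>z. h z / z) = contour_integral g k + h 0 * (\<i> * pi)"
      if "k contour_integrable_on g" "((\<lambda>z. 1 / z) has_contour_integral \<i> * pi) g"
        "path_image g \<subseteq> path_image Cp \<union> path_image Cm" for g
    proof -
      have "((\<lambda>z. k z + h 0 * (1 / z)) has_contour_integral (contour_integral g k + h 0 * (\<i> * pi))) g"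
        by (intro has_contour_integral_add has_contour_integral_lmul that has_contour_integral_integral)
      then have "((\<lambda>z. h z / z) has_contour_integral (contour_integral g k + h 0 * (\<i> * pi))) g"
        by (rule has_contour_integral_eq) (use nz that in \<open>auto simp: k_def field_simps\<close>)
      then show ?thesis by (rule contour_integral_unique)
    qed
    show "?A + ?B = 2 * pi * \<i> * h 0"
      using *[OF ki(1) intinv(1)] *[OF ki(2) intinv(2)] 0 by (simp add: algebra_simps)
  qed

  define S where "S N z = (\<Sum>n<N. c n * of_nat (Suc n) powr (-1 - z))" for N z
  have holS [simp]: "S N holomorphic_on A" for N A
    unfolding S_def by (intro holomorphic_intros)
  \<comment> \<open>The kernel is \<open>e N z / z\<close>.\<close>
  define e where "e N z = of_nat N powr z * (1 + z^2 / of_real R^2)" for N :: nat and z :: complex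
  have hole: "e N holomorphic_on A" if "N \<ge> 2" for N A
    unfolding e_def using that R by (intro holomorphic_intros) auto
  have e0: "e N 0 = 1" if "N \<ge> 2" for N using that by (simp add: e_def)

  define G where "G z = (if z = 0 then deriv F 0 else (F z - F 0) / (z - 0))" for z
  have G: "G holomorphic_on U" unfolding G_def by (intro pole_lemma_open hol)
  define H where "H z = G z * (1 + z^2 / of_real R^2)" for z
  have H: "H holomorphic_on U" unfolding H_def using R by (intro holomorphic_intros G) auto
  have sgU: "path_image sg \<subseteq> U" using sg hol(3) by fastforce
  have CpU: "path_image Cp \<subseteq> U" using Cp hol(3) by fastforce
  have "compact (path_image sg)" by (simp add: sg_def)
  have "bounded (H ` path_image sg)"
    by (intro compact_imp_bounded compact_continuous_image holomorphic_on_imp_continuous_on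
          holomorphic_on_subset[OF H] sgU \<open>compact _\<close>)
  then obtain M0 where M0: "\<And>z. z \<in> path_image sg \<Longrightarrow> norm (H z) \<le> M0"
    by (auto simp: bounded_iff)
  have "bounded (deriv H ` path_image sg)"
    by (intro compact_imp_bounded compact_continuous_image holomorphic_on_imp_continuous_on
          holomorphic_on_subset[OF holomorphic_deriv[OF H]] hol sgU \<open>compact _\<close>)
  then obtain M1 where M1: "\<And>z. z \<in> path_image sg \<Longrightarrow> norm (deriv H z) \<le> M1"
    by (auto simp: bounded_iff)
  have sgp: "\<i> * of_real R \<in> path_image sg" "-(\<i> * of_real R) \<in> path_image sg"
    by (simp_all add: sg_def)
  have M01: "M0 \<ge> 0" "M1 \<ge> 0"
    using M0[OF sgp(1)] M1[OF sgp(1)] norm_ge_zero order_trans by blast+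

  \<comment> \<open>One integration by parts: \<open>N powr z\<close> has the primitive \<open>N powr z / ln N\<close>, and its modulus is 1 on the segment.\<close>
  have segint: "norm (contour_integral sg (\<lambda>z. G z * e N z)) \<le> (2 * M0 + M1 * (2 * R)) / ln N"
    if N: "N \<ge> 2" for N :: nat
  proof -
    have lnN: "ln (real N) > 0" using N by simp
    have Nz: "norm (of_nat N powr z :: complex) = 1" if "z \<in> path_image sg" for z
      using sg[OF that] N by (simp add: norm_powr_real_powr)
    have lnc: "Ln (of_nat N) = of_real (ln (real N))" using N
      by (metis Ln_of_real of_nat_0_less_iff of_real_of_nat_eq pos2 order_less_le_trans)
    have "((\<lambda>z. deriv H z * (of_nat N powr z / of_real (ln N)) + H z * of_nat N powr z) has_contour_integral
       (H (pathfinish sg) * (of_nat N powr (pathfinish sg) / of_real (ln N))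
       - H (pathstart sg) * (of_nat N powr (pathstart sg) / of_real (ln N)))) sg" (is "(_ has_contour_integral ?b) _")
    proof (rule contour_integral_primitive[OF _ valid(3) sgU])
      fix z assume "z \<in> U"
      then have "(H has_field_derivative deriv H z) (at z)"
        using H hol(2) holomorphic_derivI by blast
      then have "((\<lambda>z. H z * (of_nat N powr z / of_real (ln N))) has_field_derivative
         deriv H z * (of_nat N powr z / of_real (ln N)) + H z * of_nat N powr z) (at z)"
        using N lnN by (auto intro!: derivative_eq_intros simp: lnc field_simps)
      then show "((\<lambda>z. H z * (of_nat N powr z / of_real (ln N))) has_field_derivative
         deriv H z * (of_nat N powr z / of_real (ln N)) + H z * of_nat N powr z) (at z within U)"
        by (rule has_field_derivative_at_within)
    qed
    moreover have int2: "(\<lambda>z. deriv H z * (of_nat N powr z / of_real (ln N))) contour_integrable_on sg"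
      using N lnN
      by (intro contour_integrable_holomorphic_simple[OF _ hol(2) valid(3) sgU] holomorphic_intros
            holomorphic_deriv[OF H] hol) auto
    ultimately have "((\<lambda>z. (deriv H z * (of_nat N powr z / of_real (ln N)) + H z * of_nat N powr z) -
        deriv H z * (of_nat N powr z / of_real (ln N))) has_contour_integral
        (?b - contour_integral sg (\<lambda>z. deriv H z * (of_nat N powr z / of_real (ln N))))) sg"
      by (intro has_contour_integral_diff has_contour_integral_integral)
    then have "((\<lambda>z. G z * e N z) has_contour_integral
        (?b - contour_integral sg (\<lambda>z. deriv H z * (of_nat N powr z / of_real (ln N))))) sg"
      by (rule has_contour_integral_eq) (simp add: H_def e_def)
    then have eq: "contour_integral sg (\<lambda>z. G z * e N z) =
       ?b - contour_integral sg (\<lambda>z. deriv H z * (of_nat N powr z / of_real (ln N)))"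
      by (rule contour_integral_unique)
    have "norm (contour_integral sg (\<lambda>z. deriv H z * (of_nat N powr z / of_real (ln N))))
       \<le> (M1 / ln N) * norm (-(\<i> * of_real R) - \<i> * of_real R)"
      using int2 unfolding sg_def
    proof (rule contour_integral_bound_linepath)
      fix x assume x: "x \<in> closed_segment (\<i> * of_real R) (-(\<i> * complex_of_real R))"
      then have "x \<in> path_image sg" by (simp add: sg_def)
      then show "norm (deriv H x * (of_nat N powr x / complex_of_real (ln N))) \<le> M1 / ln N"
        using Nz[of x] M1[of x] lnN by (simp add: norm_mult norm_divide divide_right_mono)
    qed (use M01 lnN in auto)
    also have "norm (-(\<i> * of_real R) - \<i> * of_real R) = 2 * R"
    proof -
      have "-(\<i> * of_real R) - \<i> * of_real R = -(2 * (\<i> * complex_of_real R))" by simp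
      then show ?thesis using R by (simp only: norm_minus_cancel norm_mult) simp
    qed
    finally have 1: "norm (contour_integral sg (\<lambda>z. deriv H z * (of_nat N powr z / of_real (ln N)))) \<le> M1 / ln N * (2 * R)" .
    have bd: "norm (H z * (of_nat N powr z / of_real (ln N))) \<le> M0 / ln N" if "z \<in> path_image sg" for z
      using Nz[OF that] M0[OF that] lnN by (simp add: norm_mult norm_divide divide_right_mono)
    have 2: "norm ?b \<le> M0 / ln N + M0 / ln N"
      by (rule norm_triangle_le_diff, rule add_mono) (use bd sgp in auto)
    have "norm (contour_integral sg (\<lambda>z. G z * e N z)) \<le> M0 / ln N + M0 / ln N + M1 / ln N * (2 * R)"
      unfolding eq by (rule norm_triangle_le_diff[OF add_mono[OF 2 1]])
    also have "\<dots> = (2 * M0 + M1 * (2 * R)) / ln N" by (simp add: add_divide_distrib)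
    finally show ?thesis .
  qed

  \<comment> \<open>Cauchy's theorem on the convex closed half plane: the integrand is holomorphic inside and continuous up to the boundary.\<close>
  have Cpseg: "contour_integral Cp (\<lambda>z. G z * e N z) = - contour_integral sg (\<lambda>z. G z * e N z)"
    and GeCp: "(\<lambda>z. G z * e N z) contour_integrable_on Cp" if N: "N \<ge> 2" for N
  proof -
    have hl: "(\<lambda>z. G z * e N z) holomorphic_on U" by (intro holomorphic_intros G hole N)
    show i1: "(\<lambda>z. G z * e N z) contour_integrable_on Cp"
      by (rule contour_integrable_holomorphic_simple[OF hl hol(2) valid(1) CpU])
    have i2: "(\<lambda>z. G z * e N z) contour_integrable_on sg"
      by (rule contour_integrable_holomorphic_simple[OF hl hol(2) valid(3) sgU])
    have "((\<lambda>z. G z * e N z) has_contour_integral 0) (Cp +++ sg)"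
    proof (rule Cauchy_theorem_convex[of "{z. Re z \<ge> 0}" _ "{}"])
      show "continuous_on {z. Re z \<ge> 0} (\<lambda>z. G z * e N z)"
        using holomorphic_on_imp_continuous_on[OF holomorphic_on_subset[OF hl hol(3)]] .
      show "(\<lambda>z. G z * e N z) field_differentiable at x" if "x \<in> interior {z. 0 \<le> Re z} - {}" for x
        using that interior_subset hol hl holomorphic_on_imp_differentiable_at by blast
      show "path_image (Cp +++ sg) \<subseteq> {z. 0 \<le> Re z}"
        using Cp sg by (auto simp: path_image_join)
    qed (auto intro!: valid_path_join convex_halfspace_Re_ge)
    then have "contour_integral (Cp +++ sg) (\<lambda>z. G z * e N z) = 0" by (rule contour_integral_unique)
    then show "contour_integral Cp (\<lambda>z. G z * e N z) = - contour_integral sg (\<lambda>z. G z * e N z)"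
      using i1 i2 by (simp add: add_eq_0_iff2)
  qed

  have kern: "norm (e N z / z) = real N powr Re z * (2 * \<bar>Re z\<bar> / R^2)" if "norm z = R" "N \<ge> 2" for N z
  proof -
    have zc: "z * cnj z = of_real R ^ 2" using that by (simp add: complex_norm_square[symmetric])
    have "z \<noteq> 0" using that R by auto
    then have "(1 + z^2 / of_real R^2) / z = (cnj z + z) / of_real R ^ 2"
      using R unfolding zc[symmetric] by (simp add: field_simps power2_eq_square)
    also have "cnj z + z = of_real (2 * Re z)" by (simp add: complex_eq_iff)
    finally have "e N z / z = of_nat N powr z * (of_real (2 * Re z) / of_real R ^ 2)"
      unfolding e_def by (metis times_divide_eq_right)
    then show ?thesis using that R by (simp add: norm_mult norm_divide norm_powr_real_powr norm_power)
  qed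

  have tail: "norm ((F z - S N z) * (e N z / z)) \<le> 2 * C / R^2" if z: "z \<in> path_image Cp" and N: "N \<ge> 2" for N z
  proof (cases "Re z = 0")
    case True
    then have "e N z / z = 0" using kern[of z N] Cp[OF z] N by simp
    then have "(F z - S N z) * (e N z / z) = 0" by (simp only: mult_zero_right)
    then show ?thesis using C by (simp only: norm_zero) simp
  next
    case False
    then have x: "Re z > 0" using Cp[OF z] by simp
    have "(\<lambda>n. c (n + N) * of_nat (Suc (n + N)) powr (-1 - z)) sums (F z - S N z)"
      unfolding S_def using sums_iff_shift[of "\<lambda>n. c n * of_nat (Suc n) powr (-1 - z)" N "F z - S N z"] sums[OF x]
      by (simp add: S_def)
    then have eq: "F z - S N z = (\<Sum>n. c (n + N) * of_nat (Suc (n + N)) powr (-1 - z))"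
      by (simp add: sums_iff)
    have "norm (\<Sum>n. c (n + N) * of_nat (Suc (n + N)) powr (-1 - z))
       \<le> (\<Sum>n. C * real (Suc (n + N)) powr (-1 - Re z))"
    proof (rule norm_suminf_le)
      fix n
      have "norm (of_nat (Suc (n + N)) powr (-1 - z)) = real (Suc (n + N)) powr (-1 - Re z)"
        by (subst norm_powr_real_powr) auto
      then show "norm (c (n + N) * of_nat (Suc (n + N)) powr (-1 - z)) \<le> C * real (Suc (n + N)) powr (-1 - Re z)"
        unfolding norm_mult using c by (simp add: mult_right_mono)
    qed (use suminf_powr_tail_le[of "Re z" N] x N in \<open>auto intro: summable_mult\<close>)
    also have "\<dots> = C * (\<Sum>n. real (Suc (n + N)) powr (-1 - Re z))"
      using suminf_powr_tail_le[of "Re z" N] x N by (subst suminf_mult) auto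
    also have "\<dots> \<le> C * (real N powr (-Re z) / Re z)"
      using suminf_powr_tail_le[of "Re z" N] x N C by (intro mult_left_mono) auto
    finally have "norm (F z - S N z) \<le> C * (real N powr (-Re z) / Re z)" unfolding eq .
    then have "norm ((F z - S N z) * (e N z / z)) \<le>
       C * (real N powr (-Re z) / Re z) * (real N powr Re z * (2 * \<bar>Re z\<bar> / R^2))"
      unfolding norm_mult kern[OF conjunct1[OF Cp[OF z]] N]
      by (intro mult_right_mono) auto
    also have "\<dots> = 2 * C / R^2" using x R N by (simp add: powr_minus field_simps)
    finally show ?thesis .
  qed

  have head: "norm (S N z * (e N z / z)) \<le> 2 * C / R^2 + 2 * C / (R * N)"
    if z: "z \<in> path_image Cm" and N: "N \<ge> 2" for N z
  proof (cases "Re z = 0")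
    case True
    then have "e N z / z = 0" using kern[of z N] Cm[OF z] N by simp
    then have "S N z * (e N z / z) = 0" by (simp only: mult_zero_right)
    then show ?thesis using C R by (simp only: norm_zero) simp
  next
    case False
    define x where "x = - Re z"
    have x: "x > 0" using Cm[OF z] False by (simp add: x_def)
    have xR: "x \<le> R" using Cm[OF z] abs_Re_le_cmod[of z] by (simp add: x_def)
    have "norm (S N z) \<le> (\<Sum>n<N. C * real (Suc n) powr (x - 1))"
      unfolding S_def
    proof (rule sum_norm_le)
      fix n
      have "norm (of_nat (Suc n) powr (-1 - z)) = real (Suc n) powr (x - 1)"
        by (subst norm_powr_real_powr) (auto simp: x_def minus_diff_commute)
      then show "norm (c n * of_nat (Suc n) powr (-1 - z)) \<le> C * real (Suc n) powr (x - 1)"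
        unfolding norm_mult using c by (simp add: mult_right_mono)
    qed
    also have "\<dots> = C * (\<Sum>n<N. real (Suc n) powr (x - 1))" by (simp add: sum_distrib_left)
    also have "\<dots> \<le> C * (real N powr x / x + real N powr (x - 1))"
      using sum_powr_le[OF x, of N] N C by (intro mult_left_mono) auto
    finally have "norm (S N z * (e N z / z)) \<le>
       C * (real N powr x / x + real N powr (x - 1)) * (real N powr Re z * (2 * \<bar>Re z\<bar> / R^2))"
      unfolding norm_mult kern[OF conjunct1[OF Cm[OF z]] N]
      by (intro mult_right_mono) auto
    also have "real N powr Re z = 1 / real N powr x" by (simp add: x_def powr_minus field_simps)
    also have "\<bar>Re z\<bar> = x" using x by (simp add: x_def)
    also have "C * (real N powr x / x + real N powr (x - 1)) * (1 / real N powr x * (2 * x / R^2))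
       = 2 * C / R^2 + 2 * C * x / (R^2 * N)"
      using x R N by (simp add: powr_diff field_simps)
    also have "2 * C * x / (R^2 * N) \<le> 2 * C * R / (R^2 * N)"
      using xR C R N by (intro divide_right_mono mult_left_mono) auto
    also have "2 * C * R / (R^2 * N) = 2 * C / (R * N)" using R by (simp add: power2_eq_square)
    finally show ?thesis by simp
  qed

  \<comment> \<open>Bounds the integral of \<open>F 0\<close> times the kernel over the left semicircle, since \<open>x * N powr (-x) \<le> 1 / ln N\<close>.\<close>
  have kernm: "norm (e N z / z) \<le> 2 / (R^2 * ln N)"
    if z: "z \<in> path_image Cm" and N: "N \<ge> 2" for N z
  proof -
    define x where "x = - Re z"
    have x: "x \<ge> 0" using Cm[OF z] by (simp add: x_def)
    have lnN: "ln (real N) > 0" using N by simp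
    have "x * ln N \<le> exp (x * ln N)" using exp_ge_add_one_self[of "x * ln (real N)"] by linarith
    then have "x * ln N \<le> real N powr x" using N by (simp add: powr_def)
    then have "real N powr (-x) * x \<le> 1 / ln N" using lnN N by (simp add: powr_minus field_simps)
    then have "(real N powr (-x) * x) * (2 / R^2) \<le> (1 / ln N) * (2 / R^2)" by (intro mult_right_mono) auto
    then show ?thesis unfolding kern[OF conjunct1[OF Cm[OF z]] N] using x by (simp add: x_def field_simps)
  qed

  define M where "M = norm (F 0) / R + (2 * M0 + M1 * (2 * R))"
  show thesis
  proof (rule that[of M])
    fix N :: nat assume N: "N \<ge> 2"
    have lnN: "ln (real N) > 0" using N by simp
    have Se: "(\<lambda>z. S N z * e N z) holomorphic_on UNIV" by (intro holomorphic_intros hole N holS)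
    note spS = split[OF Se] and intS = intble[OF Se]
    note spe = split[OF hole[OF N]] and inte = intble[OF hole[OF N]]
    define I1 where "I1 = contour_integral Cp (\<lambda>z. (F z - S N z) * (e N z / z))"
    define I2 where "I2 = contour_integral Cm (\<lambda>z. S N z * (e N z / z))"
    define I3 where "I3 = contour_integral Cm (\<lambda>z. e N z / z)"
    define I4 where "I4 = contour_integral sg (\<lambda>z. G z * e N z)"
    have "((\<lambda>z. (F 0 * (e N z / z) + G z * e N z) - S N z * e N z / z) has_contour_integral
        (F 0 * contour_integral Cp (\<lambda>z. e N z / z) + contour_integral Cp (\<lambda>z. G z * e N z) -
         contour_integral Cp (\<lambda>z. S N z * e N z / z))) Cp"
      by (intro has_contour_integral_diff has_contour_integral_add has_contour_integral_lmul
           has_contour_integral_integral inte intS GeCp N)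
    then have hI1: "((\<lambda>z. (F z - S N z) * (e N z / z)) has_contour_integral
        (F 0 * contour_integral Cp (\<lambda>z. e N z / z) + contour_integral Cp (\<lambda>z. G z * e N z) -
         contour_integral Cp (\<lambda>z. S N z * e N z / z))) Cp"
      by (rule has_contour_integral_eq) (use nz in \<open>auto simp: G_def field_simps\<close>)
    then have I1: "I1 = F 0 * contour_integral Cp (\<lambda>z. e N z / z) - I4 -
         contour_integral Cp (\<lambda>z. S N z * e N z / z)"
      unfolding I1_def I4_def using Cpseg[OF N] by (simp add: contour_integral_unique)
    have I2: "I2 = contour_integral Cm (\<lambda>z. S N z * e N z / z)" by (simp add: I2_def)
    have cpe: "contour_integral Cp (\<lambda>z. e N z / z) = 2 * pi * \<i> - I3"
      using spe e0[OF N] by (simp add: I3_def algebra_simps)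
    have cps: "contour_integral Cp (\<lambda>z. S N z * e N z / z) = 2 * pi * \<i> * S N 0 - I2"
      using spS e0[OF N] by (simp add: I2 algebra_simps)
    have key: "2 * pi * \<i> * (F 0 - S N 0) = I1 + F 0 * I3 + I4 - I2"
      unfolding I1 cpe cps by (simp add: algebra_simps)
    have b1: "norm I1 \<le> (2 * C / R^2) * R * pi"
    proof -
      have "norm I1 \<le> (2 * C / R^2) * R * \<bar>pi/2 - (-(pi/2))\<bar>"
        unfolding I1_def Cp_def
        by (rule contour_integral_bound_part_circlepath)
           (use hI1 tail N C R in \<open>auto simp: Cp_def contour_integrable_on_def\<close>)
      then show ?thesis by simp
    qed
    have b2: "norm I2 \<le> (2 * C / R^2 + 2 * C / (R * N)) * R * pi"
    proof -
      have "norm I2 \<le> (2 * C / R^2 + 2 * C / (R * N)) * R * \<bar>3*pi/2 - (pi/2)\<bar>"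
        unfolding I2_def Cm_def
        by (rule contour_integral_bound_part_circlepath)
           (use intS head N C R in \<open>auto simp: Cm_def\<close>)
      then show ?thesis by simp
    qed
    have b3: "norm I3 \<le> (2 / (R^2 * ln N)) * R * pi"
    proof -
      have "norm I3 \<le> (2 / (R^2 * ln N)) * R * \<bar>3*pi/2 - (pi/2)\<bar>"
        unfolding I3_def Cm_def
        by (rule contour_integral_bound_part_circlepath)
           (use inte kernm N C R in \<open>auto simp: Cm_def\<close>)
      then show ?thesis by simp
    qed
    have b4: "norm I4 \<le> (2 * M0 + M1 * (2 * R)) / ln N" (is "_ \<le> ?D / _")
      unfolding I4_def by (rule segint[OF N])
    have "2 * pi * norm (F 0 - S N 0) = norm (2 * pi * \<i> * (F 0 - S N 0))" by (simp add: norm_mult)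
    also have "\<dots> \<le> norm I1 + norm (F 0) * norm I3 + norm I4 + norm I2"
      unfolding key
      using norm_triangle_ineq4[of "I1 + F 0 * I3 + I4" I2] norm_triangle_ineq[of "I1 + F 0 * I3" I4]
        norm_triangle_ineq[of I1 "F 0 * I3"] by (simp add: norm_mult)
    also have "\<dots> \<le> (2 * C / R^2) * R * pi + norm (F 0) * ((2 / (R^2 * ln N)) * R * pi) + ?D / ln N
        + (2 * C / R^2 + 2 * C / (R * N)) * R * pi"
      by (intro add_mono mult_left_mono b1 b2 b3 b4) auto
    also have "\<dots> = 2 * pi * (2 * C / R + C / N + norm (F 0) / R / ln N) + ?D / ln N"
      using R lnN N by (simp add: field_simps power2_eq_square)
    also have "?D / ln N \<le> 2 * pi * (?D / ln N)"
    proof -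
      have "?D / ln N \<ge> 0" using M01 R lnN by (intro divide_nonneg_pos add_nonneg_nonneg mult_nonneg_nonneg) auto
      then show ?thesis using mult_right_mono[of 1 "2 * pi" "?D / ln N"] pi_gt3 by simp
    qed
    also have "2 * pi * (2 * C / R + C / N + norm (F 0) / R / ln N) + 2 * pi * (?D / ln N) =
       2 * pi * (2 * C / R + C / N + M / ln N)"
      by (simp add: M_def add_divide_distrib algebra_simps)
    finally have "norm (F 0 - S N 0) \<le> 2 * C / R + C / N + M / ln N" by simp
    moreover have "S N 0 = (\<Sum>n<N. c n / of_nat (Suc n))"
      unfolding S_def by (simp add: powr_minus divide_inverse del: of_nat_Suc)
    ultimately show "norm (F 0 - (\<Sum>n<N. c n / of_nat (Suc n))) \<le> 2 * C / R + C / N + M / ln N" by simp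
  qed
qed

text \<open>Newman's Tauberian theorem: with bounded coefficients, holomorphic continuation to a neighbourhood
  of the closed half plane forces convergence at its boundary point 0. Given \<open>\<epsilon>\<close>, fix \<open>R\<close> with
  \<open>2 * C / R < \<epsilon>\<close> in the contour estimate and let \<open>N\<close> tend to infinity.\<close>
theorem newman:
  fixes c :: "nat \<Rightarrow> complex" and F :: "complex \<Rightarrow> complex"
  assumes c: "\<And>n. norm (c n) \<le> C"
    and hol: "F holomorphic_on U" "open U" "{z. Re z \<ge> 0} \<subseteq> U"
    and sums: "\<And>z. Re z > 0 \<Longrightarrow> (\<lambda>n. c n * of_nat (Suc n) powr (-1 - z)) sums F z"
  shows "(\<lambda>n. c n / of_nat (Suc n)) sums F 0"
  unfolding sums_def tendsto_iff
proof (intro allI impI)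
  fix \<epsilon> :: real assume \<epsilon>: "\<epsilon> > 0"
  have C: "C \<ge> 0" using c[of 0] norm_ge_zero order_trans by blast
  \<comment> \<open>The choice \<open>4 * C / \<epsilon>\<close> would not be positive for \<open>C = 0\<close>.\<close>
  define R where "R = 4 * (C + 1) / \<epsilon>"
  have R: "R > 0" using \<epsilon> C by (simp add: R_def)
  have CR: "2 * C / R < \<epsilon>" using \<epsilon> C by (simp add: R_def field_simps add_pos_nonneg)
  obtain M where M: "\<And>N. N \<ge> 2 \<Longrightarrow>
     norm (F 0 - (\<Sum>n<N. c n / of_nat (Suc n))) \<le> 2 * C / R + C / N + M / ln N"
    using newman_bound[OF c hol sums R] by blast
  have "(\<lambda>N. 2 * C / R + C / real N + M / ln (real N)) \<longlonglongrightarrow> 2 * C / R + 0 + 0"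
    by (intro tendsto_intros tendsto_divide_0[OF tendsto_const] filterlim_at_top_imp_at_infinity
         filterlim_real_sequentially filterlim_compose[OF ln_at_top filterlim_real_sequentially])
  then have "\<forall>\<^sub>F N in sequentially. 2 * C / R + C / real N + M / ln (real N) < \<epsilon>"
    using CR by (intro order_tendstoD) auto
  with eventually_ge_at_top[of 2]
  show "\<forall>\<^sub>F N in sequentially. dist (\<Sum>n<N. c n / of_nat (Suc n)) (F 0) < \<epsilon>"
  proof eventually_elim
    case (elim N)
    then show ?case using M[of N] by (simp add: dist_norm norm_minus_commute)
  qed
qed

section \<open>The zeta function near the line of real part one\<close>

lemma norm_nat_powr: "norm (of_nat (Suc n) powr s :: complex) = real (Suc n) powr Re s"
  by (subst norm_powr_real_powr) auto

lemma has_field_derivative_nat_powr: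
  "((\<lambda>s. of_nat (Suc n) powr (-s)) has_field_derivative - of_real (ln (real (Suc n))) * of_nat (Suc n) powr (-s :: complex)) (at s)"
proof -
  have "Ln (of_nat (Suc n)) = complex_of_real (ln (real (Suc n)))"
    by (metis Ln_of_real of_nat_0_less_iff of_real_of_nat_eq zero_less_Suc)
  moreover have "((\<lambda>s. a powr (-s)) has_field_derivative - Ln a * a powr (-s)) (at s)"
    if "a \<noteq> 0" for a :: complex
  proof -
    have "(uminus has_field_derivative -1) (at s)" by (auto intro!: derivative_eq_intros)
    from DERIV_chain2[OF has_field_derivative_powr_right[OF that] this] show ?thesis by simp
  qed
  ultimately show ?thesis by (metis of_nat_neq_0)
qed

text \<open>The second-order Taylor estimate for \<open>x powr w\<close> on the unit interval above \<open>n + 1\<close>. Replacing a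
  difference of powers by its derivative gains a factor \<open>n^2\<close> over the power itself. This
  is what continues Dirichlet series one unit to the left. It is used for zeta and again
  in the summation by parts of the Chebyshev function.\<close>
lemma powr_second_difference:
  fixes w :: complex
  assumes "Re w \<le> 2"
  shows "norm (of_nat (Suc (Suc n)) powr w - of_nat (Suc n) powr w - w * of_nat (Suc n) powr (w - 1))
     \<le> norm w * norm (w - 1) * real (Suc n) powr (Re w - 2)"
proof -
  define f where "f i = (\<lambda>x::complex. if i = (0::nat) then x powr w else if i = 1 then w * x powr (w - 1)
      else w * (w - 1) * x powr (w - 2))" for i
  define a b :: complex where "a = of_nat (Suc n)" and "b = of_nat (Suc (Suc n))"
  have seg: "\<exists>t. x = of_real t \<and> t \<ge> real (Suc n)" if "x \<in> closed_segment a b" for x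
  proof -
    obtain u where "0 \<le> u" "u \<le> 1" "x = (1 - u) *\<^sub>R a + u *\<^sub>R b"
      using \<open>x \<in> _\<close> by (auto simp: closed_segment_def)
    then show ?thesis
      by (intro exI[of _ "real (Suc n) + u"]) (auto simp: a_def b_def scaleR_conv_of_real algebra_simps)
  qed
  have "cmod (f 0 b - (\<Sum>i\<le>1. f i a * (b - a) ^ i / fact i))
     \<le> (norm w * norm (w - 1) * real (Suc n) powr (Re w - 2)) * cmod (b - a) ^ Suc 1 / fact 1"
  proof (rule complex_Taylor[where S = "closed_segment a b"])
    fix i x assume x: "x \<in> closed_segment a b" and i: "i \<le> (1::nat)"
    obtain t where t: "x = of_real t" "t \<ge> real (Suc n)" using seg[OF x] by blast
    have "x \<notin> \<real>\<^sub>\<le>\<^sub>0" using t by (auto simp: complex_nonpos_Reals_iff)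
    then have "(f i has_field_derivative f (Suc i) x) (at x)"
      using i unfolding f_def
      by (cases i) (auto intro!: derivative_eq_intros simp: algebra_simps)
    then show "(f i has_field_derivative f (Suc i) x) (at x within closed_segment a b)"
      by (rule has_field_derivative_at_within)
  next
    fix x assume x: "x \<in> closed_segment a b"
    obtain t where t: "x = of_real t" "t \<ge> real (Suc n)" using seg[OF x] by blast
    have "norm (x powr (w - 2)) = t powr (Re w - 2)"
      using t by (simp add: norm_powr_real_powr)
    also have "\<dots> \<le> real (Suc n) powr (Re w - 2)"
      using t assms by (intro powr_mono2') auto
    finally show "cmod (f (Suc 1) x) \<le> norm w * norm (w - 1) * real (Suc n) powr (Re w - 2)"
      by (simp add: f_def norm_mult mult_left_mono)
  qed auto
  then show ?thesis by (simp add: f_def a_def b_def algebra_simps)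
qed

text \<open>Termwise differentiation under the shape of bound met here: near a point with \<open>Re s > a\<close> the
  exponent is at most \<open>-1 - d\<close> for a fixed \<open>d > 0\<close> and the continuous factor \<open>B\<close> is bounded, which
  gives a summable majorant.\<close>
lemma half_plane_series:
  fixes f :: "nat \<Rightarrow> complex \<Rightarrow> complex" and B :: "complex \<Rightarrow> real"
  assumes der: "\<And>n s. Re s > a \<Longrightarrow> (f n has_field_derivative f' n s) (at s)"
    and bound: "\<And>n s. Re s > a \<Longrightarrow> norm (f n s) \<le> B s * real (Suc n) powr (-1 - (Re s - a))"
    and B: "continuous_on UNIV B"
  shows "\<And>s. Re s > a \<Longrightarrow> summable (\<lambda>n. f n s)"
    and "(\<lambda>s. \<Sum>n. f n s) holomorphic_on {s. Re s > a}"
    and "\<And>s. Re s > a \<Longrightarrow> (\<lambda>n. f' n s) sums deriv (\<lambda>s. \<Sum>n. f n s) s"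
proof -
  let ?S = "{s. Re s > a}"
  have S: "open ?S" by (rule open_halfspace_Re_gt)
  have "\<exists>g g'. \<forall>x \<in> ?S. ((\<lambda>n. f n x) sums g x) \<and> ((\<lambda>n. f' n x) sums g' x) \<and> (g has_field_derivative g' x) (at x)"
  proof (rule series_and_derivative_comparison_local[OF S])
    fix s0 assume "s0 \<in> ?S"
    then have s0: "Re s0 > a" by simp
    define d where "d = (Re s0 - a) / 2"
    have d: "d > 0" using s0 by (simp add: d_def)
    have "bounded (B ` cball s0 d)"
      by (intro compact_imp_bounded compact_continuous_image continuous_on_subset[OF B]) auto
    then obtain K where K: "\<And>s. s \<in> cball s0 d \<Longrightarrow> norm (B s) \<le> K"
      unfolding bounded_iff by blast
    have K0: "K \<ge> 0" using K[of s0] d by (auto intro: order_trans[OF norm_ge_zero])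
    have sm: "summable (\<lambda>n. K * real (Suc n) powr (-1 - d))"
      using summable_real_powr_iff[of "-1 - d"] d by (intro summable_mult) (subst summable_Suc_iff, simp)
    have "\<forall>y\<in>ball s0 d \<inter> ?S. norm (f n y) \<le> K * real (Suc n) powr (-1 - d)" for n
    proof
      fix y assume y: "y \<in> ball s0 d \<inter> ?S"
      have "\<bar>Re s0 - Re y\<bar> < d" using y abs_Re_le_cmod[of "s0 - y"] by (simp add: dist_norm)
      then have Re: "Re y - a \<ge> d" by (simp add: d_def abs_if field_simps split: if_splits)
      have "norm (f n y) \<le> B y * real (Suc n) powr (-1 - (Re y - a))" using bound y by simp
      also have "\<dots> \<le> K * real (Suc n) powr (-1 - d)"
        using K[of y] y Re K0 by (intro mult_mono powr_mono) auto
      finally show "norm (f n y) \<le> K * real (Suc n) powr (-1 - d)" .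
    qed
    then show "\<exists>d h. 0 < d \<and> summable h \<and> (\<forall>\<^sub>F n in sequentially. \<forall>y\<in>ball s0 d \<inter> ?S. norm (f n y) \<le> h n)"
      using d sm
      by (intro exI[of _ d] exI[of _ "\<lambda>n. K * real (Suc n) powr (-1 - d)"] conjI always_eventually allI) auto
  qed (use der in simp)
  then obtain g g' where g: "\<And>x. x \<in> ?S \<Longrightarrow> ((\<lambda>n. f n x) sums g x)" "\<And>x. x \<in> ?S \<Longrightarrow> ((\<lambda>n. f' n x) sums g' x)"
     "\<And>x. x \<in> ?S \<Longrightarrow> (g has_field_derivative g' x) (at x)" by blast
  show "\<And>s. Re s > a \<Longrightarrow> summable (\<lambda>n. f n s)" using g(1) sums_summable by blast
  have geq: "(\<Sum>n. f n s) = g s" if "s \<in> ?S" for s using g(1)[OF that] by (simp add: sums_iff)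
  have "g holomorphic_on ?S" using g(3) S by (auto simp: holomorphic_on_open)
  then show "(\<lambda>s. \<Sum>n. f n s) holomorphic_on ?S"
    by (rule holomorphic_transform) (use geq in simp)
  fix s assume s: "Re s > a"
  have "((\<lambda>s. \<Sum>n. f n s) has_field_derivative g' s) (at s)"
    by (rule has_field_derivative_transform_within_open[OF g(3) S]) (use s geq in auto)
  then show "(\<lambda>n. f' n s) sums deriv (\<lambda>s. \<Sum>n. f n s) s"
    using g(2)[of s] s by (simp add: DERIV_imp_deriv)
qed

definition zeta_series :: "complex \<Rightarrow> complex" where
  "zeta_series s = (\<Sum>n. of_nat (Suc n) powr (-s))"

definition mangoldt_series :: "complex \<Rightarrow> complex" where
  "mangoldt_series s = (\<Sum>n. mangoldt (Suc n) * of_nat (Suc n) powr (-s))"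

text \<open>This is \<open>(s - 1) * zeta s\<close>. The differences of \<open>powr (1 - s)\<close> telescope to \<open>-1\<close> for \<open>Re s > 1\<close>, and
  they cancel the main part of each term, so that the series converges for \<open>Re s > 0\<close>. Working
  with this function instead of zeta removes the pole at 1 from every argument.\<close>
definition zeta_reg :: "complex \<Rightarrow> complex" where
  "zeta_reg s = 1 + (\<Sum>n. of_nat (Suc (Suc n)) powr (1 - s) - of_nat (Suc n) powr (1 - s)
      + (s - 1) * of_nat (Suc n) powr (-s))"

lemma summable_nat_powr:
  assumes "Re s > 1"
  shows "summable (\<lambda>n. norm (of_nat (Suc n) powr (-s) :: complex))"
  using assms summable_real_powr_iff[of "-Re s"] unfolding norm_nat_powr
  by (subst summable_Suc_iff) simp

lemma zeta_series_holomorphic: "zeta_series holomorphic_on {s. Re s > 1}"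
  and zeta_series_deriv: "Re s > 1 \<Longrightarrow>
    (\<lambda>n. - of_real (ln (real (Suc n))) * of_nat (Suc n) powr (-s)) sums deriv zeta_series s"
proof -
  have eq: "zeta_series = (\<lambda>s. \<Sum>n. of_nat (Suc n) powr (-s))"
    by (simp add: fun_eq_iff zeta_series_def)
  note hp = half_plane_series[where a = 1 and f = "\<lambda>n s. of_nat (Suc n) powr (-s)" and
     f' = "\<lambda>n s. - of_real (ln (real (Suc n))) * of_nat (Suc n) powr (-s)" and B = "\<lambda>_. 1",
     OF has_field_derivative_nat_powr _ continuous_on_const]
  show "zeta_series holomorphic_on {s. Re s > 1}"
    unfolding eq by (rule hp(2)) (simp add: norm_nat_powr del: of_nat_Suc)
  show "Re s > 1 \<Longrightarrow>
    (\<lambda>n. - of_real (ln (real (Suc n))) * of_nat (Suc n) powr (-s)) sums deriv zeta_series s"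
    unfolding eq by (rule hp(3)) (simp_all add: norm_nat_powr del: of_nat_Suc)
qed

lemma zeta_reg_term_bound:
  assumes "Re s > 0"
  shows "norm (of_nat (Suc (Suc n)) powr (1 - s) - of_nat (Suc n) powr (1 - s)
      + (s - 1) * of_nat (Suc n) powr (-s)) \<le> norm (1 - s) * norm s * real (Suc n) powr (-1 - (Re s - 0))"
proof -
  have "of_nat (Suc (Suc n)) powr (1 - s) - of_nat (Suc n) powr (1 - s)
      + (s - 1) * of_nat (Suc n) powr (-s) =
      of_nat (Suc (Suc n)) powr (1 - s) - of_nat (Suc n) powr (1 - s)
      - (1 - s) * of_nat (Suc n) powr ((1 - s) - 1)"
    by (simp add: algebra_simps)
  also have "norm \<dots> \<le> norm (1 - s) * norm ((1 - s) - 1) * real (Suc n) powr (Re (1 - s) - 2)"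
    by (rule powr_second_difference) (use assms in auto)
  finally show ?thesis by (simp add: minus_diff_commute del: of_nat_Suc)
qed

lemma zeta_reg_holomorphic: "zeta_reg holomorphic_on {s. Re s > 0}"
proof -
  let ?f = "\<lambda>n s. of_nat (Suc (Suc n)) powr (1 - s) - of_nat (Suc n) powr (1 - s)
      + (s - 1) * of_nat (Suc n) powr (-s) :: complex"
  have eq: "zeta_reg = (\<lambda>s. 1 + (\<Sum>n. ?f n s))"
    by (simp add: fun_eq_iff zeta_reg_def)
  have hol: "?f n holomorphic_on UNIV" for n by (intro holomorphic_intros)
  have der: "(?f n has_field_derivative deriv (?f n) s) (at s)" for n s
    using holomorphic_derivI[OF hol open_UNIV] by simp
  have cont: "continuous_on UNIV (\<lambda>s::complex. norm (1 - s) * norm s)"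
    by (intro continuous_intros)
  note hp = half_plane_series[where a = 0 and f = "?f" and B = "\<lambda>s. norm (1 - s) * norm s",
     OF der zeta_reg_term_bound cont]
  show "zeta_reg holomorphic_on {s. Re s > 0}"
    unfolding eq by (intro holomorphic_intros hp(2))
qed

lemma zeta_reg_1: "zeta_reg 1 = 1"
  by (simp add: zeta_reg_def del: of_nat_Suc)

lemma zeta_reg_eq:
  assumes s: "Re s > 1"
  shows "zeta_reg s = (s - 1) * zeta_series s"
proof -
  have "(\<lambda>n. norm (of_nat (Suc n) powr (1 - s) :: complex)) \<longlonglongrightarrow> 0"
    unfolding norm_nat_powr
    by (intro tendsto_neg_powr filterlim_compose[OF filterlim_real_sequentially] filterlim_Suc) (use s in auto)
  then have lim: "(\<lambda>n. of_nat (Suc n) powr (1 - s) :: complex) \<longlonglongrightarrow> 0"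
    by (rule tendsto_norm_zero_cancel)
  have 1: "(\<lambda>n. of_nat (Suc (Suc n)) powr (1 - s) - of_nat (Suc n) powr (1 - s)) sums (0 - of_nat (Suc 0) powr (1 - s) :: complex)"
    by (rule telescope_sums[OF lim])
  have 2: "(\<lambda>n. (s - 1) * of_nat (Suc n) powr (-s)) sums ((s - 1) * zeta_series s)"
    unfolding zeta_series_def using summable_nat_powr[OF s]
    by (intro sums_mult summable_sums) (rule summable_norm_cancel)
  show ?thesis unfolding zeta_reg_def sums_unique[OF sums_add[OF 1 2], symmetric] by simp
qed

lemma summable_mangoldt_powr:
  assumes s: "Re s > 1"
  shows "summable (\<lambda>n. norm (mangoldt (Suc n) * of_nat (Suc n) powr (-s) :: complex))"
proof -
  define d where "d = (Re s - 1) / 2"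
  have d: "d > 0" using s by (simp add: d_def)
  have "summable (\<lambda>n. 1 / d * real (Suc n) powr (-1 - d))"
    using summable_real_powr_iff[of "-1 - d"] d by (intro summable_mult) (subst summable_Suc_iff, simp)
  then show ?thesis
  proof (rule summable_comparison_test_ev[rotated], intro always_eventually allI)
    fix n
    have "ln (real (Suc n)) \<le> real (Suc n) powr d / d"
      using ln_powr_bound[of "real (Suc n)" d] d by simp
    moreover have "(mangoldt (Suc n) :: real) \<le> ln (real (Suc n))"
      by (rule mangoldt_le) simp
    ultimately have "norm (mangoldt (Suc n) * of_nat (Suc n) powr (-s) :: complex) \<le>
       (real (Suc n) powr d / d) * real (Suc n) powr (-Re s)"
      unfolding norm_mult norm_nat_powr norm_mangoldt uminus_complex.sel by (intro mult_right_mono) auto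
    also have "\<dots> = 1 / d * real (Suc n) powr (d + -Re s)"
      by (subst powr_add) simp
    also have "d + - Re s = -1 - d" by (simp add: d_def field_simps)
    finally show "norm (norm (mangoldt (Suc n) * of_nat (Suc n) powr (-s) :: complex)) \<le> 1 / d * real (Suc n) powr (-1 - d)"
      by simp
  qed
qed

lemma has_sum_positive_nat:
  fixes f :: "nat \<Rightarrow> complex"
  assumes "summable (\<lambda>n. norm (f (Suc n)))" "(\<lambda>n. f (Suc n)) sums S"
  shows "(f has_sum S) {0<..}" and "(\<lambda>n. norm (f n)) summable_on {0<..}"
proof -
  have bij: "bij_betw Suc UNIV {0<..}"
    by (rule bij_betwI[where g = "\<lambda>n. n - 1"]) auto
  show "(f has_sum S) {0<..}"
    using norm_summable_imp_has_sum[OF assms] has_sum_reindex_bij_betw[OF bij, of f S] by simp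
  show "(\<lambda>n. norm (f n)) summable_on {0<..}"
    using summable_on_reindex_bij_betw[OF bij, of "\<lambda>n. norm (f n)"] assms(1)
      norm_summable_imp_summable_on[of "\<lambda>n. norm (f (Suc n))"] by simp
qed

text \<open>The Dirichlet series form of \<open>(\<Sum>d | d dvd n. mangoldt d) = ln n\<close>. The product of the two series is an
  absolutely convergent sum over pairs \<open>(d, m)\<close>. Grouping the pairs by \<open>n = d * m\<close> gives the
  termwise derivative of zeta, up to sign.\<close>
lemma mangoldt_series_times_zeta:
  assumes s: "Re s > 1"
  shows "mangoldt_series s * zeta_series s = - deriv zeta_series s"
proof -
  let ?A = "{0<..} :: nat set"
  define f where "f = (\<lambda>(d, m). (mangoldt d * of_nat d powr (-s)) * of_nat m powr (-s) :: complex)"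
  have "(\<lambda>n. of_nat (Suc n) powr (-s)) sums zeta_series s"
    unfolding zeta_series_def by (intro summable_sums summable_norm_cancel[OF summable_nat_powr[OF s]])
  note z = has_sum_positive_nat[where f = "\<lambda>n. of_nat n powr (-s)", OF summable_nat_powr[OF s] this]
  have "(\<lambda>n. mangoldt (Suc n) * of_nat (Suc n) powr (-s)) sums mangoldt_series s"
    unfolding mangoldt_series_def by (intro summable_sums summable_norm_cancel[OF summable_mangoldt_powr[OF s]])
  note L = has_sum_positive_nat[where f = "\<lambda>n. mangoldt n * of_nat n powr (-s)", OF summable_mangoldt_powr[OF s] this]
  have inner: "((\<lambda>m. f (d, m)) has_sum (mangoldt d * of_nat d powr (-s) * zeta_series s)) ?A" for d
    unfolding f_def using has_sum_cmult_right[OF z(1)] by simp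
  have "(\<lambda>x. norm (f x)) summable_on (?A \<times> ?A)"
  proof (rule iffD2[OF Infinite_Sum.abs_summable_on_Sigma_iff], intro conjI ballI)
    fix d show "(\<lambda>m. norm (f (d, m))) summable_on ?A"
      unfolding f_def using summable_on_cmult_right[OF z(2)] by (simp add: norm_mult)
  next
    have "(\<lambda>d. norm (mangoldt d * of_nat d powr (-s) :: complex) * (\<Sum>\<^sub>\<infinity>m\<in>?A. norm (of_nat m powr (-s) :: complex))) summable_on ?A"
      by (rule summable_on_cmult_left[OF L(2)])
    moreover have "(\<Sum>\<^sub>\<infinity>m\<in>?A. norm (f (d, m))) = norm (mangoldt d * of_nat d powr (-s) :: complex) * (\<Sum>\<^sub>\<infinity>m\<in>?A. norm (of_nat m powr (-s) :: complex))" for d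
      unfolding f_def by (simp add: norm_mult infsum_cmult_right')
    ultimately show "(\<lambda>d. norm (\<Sum>\<^sub>\<infinity>m\<in>?A. norm (f (d, m)))) summable_on ?A"
      by (simp add: infsum_nonneg abs_mult)
  qed
  then have "f summable_on (?A \<times> ?A)" by (rule abs_summable_summable)
  then obtain T where T: "(f has_sum T) (?A \<times> ?A)" using summable_on_def by blast
  have "((\<lambda>d. mangoldt d * of_nat d powr (-s) * zeta_series s) has_sum T) ?A"
    by (rule has_sum_SigmaD[OF T inner])
  moreover have "((\<lambda>d. mangoldt d * of_nat d powr (-s) * zeta_series s) has_sum (mangoldt_series s * zeta_series s)) ?A"
    by (rule has_sum_cmult_left[OF L(1)])
  ultimately have T1: "T = mangoldt_series s * zeta_series s" by (rule has_sum_unique)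
  define g where "g = (\<lambda>(n, d). mangoldt d * of_nat n powr (-s) :: complex)"
  have "(g has_sum T) (Sigma ?A (\<lambda>n. {d. d dvd n})) \<longleftrightarrow> (f has_sum T) (?A \<times> ?A)"
  proof (rule has_sum_reindex_bij_witness[where i = "\<lambda>(d, m). (d * m, d)" and j = "\<lambda>(n, d). (d, n div d)"])
    fix x assume "x \<in> Sigma ?A (\<lambda>n. {d. d dvd n})"
    then obtain d k where x: "x = (d * k, d)" "d > 0" "k > 0" by (auto elim!: dvdE)
    have "of_nat (d * k) powr (-s) = (of_nat d powr (-s) * of_nat k powr (-s) :: complex)"
      using powr_times_real[of "of_nat d" "of_nat k" "-s"] by simp
    then show "f (case x of (n, d) \<Rightarrow> (d, n div d)) = g x"
      using x by (simp add: f_def g_def)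
  qed auto
  with T have "(g has_sum T) (Sigma ?A (\<lambda>n. {d. d dvd n}))" by simp
  then have "((\<lambda>n. of_real (ln (real n)) * of_nat n powr (-s)) has_sum T) ?A"
  proof (rule has_sum_SigmaD)
    fix n :: nat assume n: "n \<in> ?A"
    have "((\<lambda>d. g (n, d)) has_sum (\<Sum>d | d dvd n. g (n, d))) {d. d dvd n}"
      using n by (intro has_sum_finite) auto
    also have "(\<Sum>d | d dvd n. g (n, d)) = (\<Sum>d | d dvd n. mangoldt d) * of_nat n powr (-s)"
      by (simp add: g_def sum_distrib_right)
    also have "(\<Sum>d | d dvd n. mangoldt d :: complex) = of_real (ln (real n))"
      using n by (intro mangoldt_sum) auto
    finally show "((\<lambda>d. g (n, d)) has_sum (of_real (ln (real n)) * of_nat n powr (-s))) {d. d dvd n}" .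
  qed
  then have "((\<lambda>n. of_real (ln (real (Suc n))) * of_nat (Suc n) powr (-s)) has_sum T) UNIV"
    using has_sum_reindex_bij_betw[of Suc UNIV ?A "\<lambda>n. of_real (ln (real n)) * of_nat n powr (-s)" T]
      bij_betwI[of Suc UNIV ?A "\<lambda>n. n - 1"] by auto
  then have "(\<lambda>n. of_real (ln (real (Suc n))) * of_nat (Suc n) powr (-s)) sums T"
    by (rule has_sum_imp_sums)
  then have "(\<lambda>n. - (of_real (ln (real (Suc n))) * of_nat (Suc n) powr (-s))) sums (-T)"
    by (rule sums_minus)
  moreover have "(\<lambda>n. - (of_real (ln (real (Suc n))) * of_nat (Suc n) powr (-s))) sums deriv zeta_series s"
    using zeta_series_deriv[OF s] by simp
  ultimately have "-T = deriv zeta_series s" by (rule sums_unique2)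
  then show ?thesis using T1 by (metis minus_minus)
qed

text \<open>The logarithmic derivative of \<open>(s - 1) * zeta s\<close>, where \<open>zeta' / zeta\<close> is \<open>- mangoldt_series\<close>.\<close>
lemma zeta_reg_logderiv:
  assumes s: "Re s > 1" and nz: "zeta_reg s \<noteq> 0"
  shows "mangoldt_series s = 1 / (s - 1) - deriv zeta_reg s / zeta_reg s"
proof -
  have s1: "s \<noteq> 1" using s by auto
  have z: "zeta_series s \<noteq> 0" using nz zeta_reg_eq[OF s] by auto
  have "(zeta_series has_field_derivative deriv zeta_series s) (at s)"
    using holomorphic_derivI[OF zeta_series_holomorphic open_halfspace_Re_gt] s by simp
  then have "((\<lambda>s. (s - 1) * zeta_series s) has_field_derivative (zeta_series s + (s - 1) * deriv zeta_series s)) (at s)"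
    by (auto intro!: derivative_eq_intros)
  then have "(zeta_reg has_field_derivative (zeta_series s + (s - 1) * deriv zeta_series s)) (at s)"
    by (rule has_field_derivative_transform_within_open[OF _ open_halfspace_Re_gt[of 1]]) (use s zeta_reg_eq in auto)
  then have "deriv zeta_reg s = zeta_series s + (s - 1) * deriv zeta_series s" by (rule DERIV_imp_deriv)
  also have "deriv zeta_series s = - (mangoldt_series s * zeta_series s)"
    using mangoldt_series_times_zeta[OF s] by simp
  finally have "deriv zeta_reg s = zeta_series s - (s - 1) * mangoldt_series s * zeta_series s" by simp
  moreover have "(zeta_series s - u * mangoldt_series s * zeta_series s) / (u * zeta_series s) = 1 / u - mangoldt_series s"
    if "u \<noteq> 0" for u using that z by (simp add: field_simps)
  ultimately show ?thesis using s1 unfolding zeta_reg_eq[OF s] by simp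
qed

section \<open>Nonvanishing of zeta on the line of real part one\<close>

text \<open>The residue of the logarithmic derivative is the order of vanishing.\<close>
lemma logderiv_limit:
  assumes f: "f holomorphic_on S" "open S" "connected S" and z0: "z0 \<in> S" and w: "w \<in> S" "f w \<noteq> 0"
  obtains m :: nat where "m = 0 \<longleftrightarrow> f z0 \<noteq> 0" "((\<lambda>z. (z - z0) * (deriv f z / f z)) \<longlongrightarrow> of_nat m) (at z0)"
proof (cases "f z0 = 0")
  case False
  have "isCont f z0" "isCont (deriv f) z0"
    using f z0 holomorphic_deriv holomorphic_on_imp_continuous_on continuous_on_eq_continuous_at by blast+
  then have "((\<lambda>z. (z - z0) * (deriv f z / f z)) \<longlongrightarrow> (z0 - z0) * (deriv f z0 / f z0)) (at z0)"
    by (intro tendsto_intros False) (auto simp: isCont_def)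
  then show thesis using that[of 0] False by simp
next
  case True
  then have "\<not> f constant_on S" unfolding constant_on_def using z0 w by metis
  then obtain g r n where n: "0 < n" "0 < r" "ball z0 r \<subseteq> S" "g holomorphic_on ball z0 r"
    "\<And>w. w \<in> ball z0 r \<Longrightarrow> f w = (w - z0)^n * g w" "\<And>w. w \<in> ball z0 r \<Longrightarrow> g w \<noteq> 0"
    using holomorphic_factor_zero_nonconstant[OF f z0 True] by metis
  have z0r: "z0 \<in> ball z0 r" using n by simp
  have "isCont g z0" "isCont (deriv g) z0"
    using n z0r holomorphic_deriv[OF n(4)] holomorphic_on_imp_continuous_on continuous_on_eq_continuous_at open_ball by blast+
  then have "((\<lambda>z. of_nat n + (z - z0) * (deriv g z / g z)) \<longlongrightarrow> of_nat n + (z0 - z0) * (deriv g z0 / g z0)) (at z0)"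
    using n(6)[OF z0r] by (intro tendsto_intros) (auto simp: isCont_def)
  then have lim: "((\<lambda>z. of_nat n + (z - z0) * (deriv g z / g z)) \<longlongrightarrow> of_nat n) (at z0)" by simp
  have "((\<lambda>z. (z - z0) * (deriv f z / f z)) \<longlongrightarrow> of_nat n) (at z0)"
  proof (rule Lim_transform_within_open[OF lim open_ball z0r])
    fix z assume z: "z \<in> ball z0 r" "z \<noteq> z0"
    have "(g has_field_derivative deriv g z) (at z)"
      using holomorphic_derivI[OF n(4) open_ball z(1)] .
    then have "((\<lambda>w. (w - z0)^n * g w) has_field_derivative (of_nat n * (z - z0)^(n-1) * g z + (z - z0)^n * deriv g z)) (at z)"
      by (auto intro!: derivative_eq_intros)
    then have "(f has_field_derivative (of_nat n * (z - z0)^(n-1) * g z + (z - z0)^n * deriv g z)) (at z)"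
      by (rule has_field_derivative_transform_within_open[OF _ open_ball z(1)]) (use n(5) in auto)
    then have df: "deriv f z = of_nat n * (z - z0)^(n-1) * g z + (z - z0) * (z - z0)^(n-1) * deriv g z"
      using n(1) by (cases n) (auto dest: DERIV_imp_deriv)
    have fz: "f z = (z - z0) * (z - z0)^(n-1) * g z"
      using n(5)[OF z(1)] n(1) by (cases n) auto
    have alg: "k + u * (b / a) = u * ((k * q * a + u * q * b) / (u * q * a))"
      if "u \<noteq> 0" "q \<noteq> 0" "a \<noteq> 0" for k u q a b :: complex using that by (simp add: field_simps)
    show "of_nat n + (z - z0) * (deriv g z / g z) = (z - z0) * (deriv f z / f z)"
      unfolding df fz by (rule alg) (use n(6)[OF z(1)] z(2) in auto)
  qed
  then show thesis using that[of n] n True by auto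
qed


lemma zeta_reg_logderiv_limit:
  assumes "Re s0 > 0"
  obtains m :: nat where "m = 0 \<longleftrightarrow> zeta_reg s0 \<noteq> 0"
    "((\<lambda>x. of_real x * (deriv zeta_reg (s0 + of_real x) / zeta_reg (s0 + of_real x))) \<longlongrightarrow> of_nat m) (at_right 0)"
proof -
  obtain m where m: "m = 0 \<longleftrightarrow> zeta_reg s0 \<noteq> 0" 
     "((\<lambda>z. (z - s0) * (deriv zeta_reg z / zeta_reg z)) \<longlongrightarrow> of_nat m) (at s0)"
    by (rule logderiv_limit[OF zeta_reg_holomorphic, of s0 1])
       (use assms zeta_reg_1 in \<open>auto intro: open_halfspace_Re_gt convex_connected convex_halfspace_Re_gt\<close>)
  have "filterlim (\<lambda>x::real. s0 + of_real x) (at s0) (at_right 0)"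
    unfolding filterlim_at
  proof
    have "((\<lambda>x::real. s0 + of_real x) \<longlongrightarrow> s0 + of_real 0) (at_right 0)"
      by (intro tendsto_intros)
    then show "((\<lambda>x::real. s0 + of_real x) \<longlongrightarrow> s0) (at_right 0)" by simp
  qed (auto simp: eventually_at_filter)
  from filterlim_compose[OF m(2) this] show thesis using that[OF m(1)] by simp
qed

lemma norm_mangoldt_series_le:
  assumes "1 < x" "x \<le> Re s"
  shows "norm (mangoldt_series s) \<le> (\<Sum>n. mangoldt (Suc n) * real (Suc n) powr (-x))"
proof -
  have "summable (\<lambda>n. norm (mangoldt (Suc n) * of_nat (Suc n) powr (-(of_real x)) :: complex))"
    by (rule summable_mangoldt_powr) (use assms in auto)
  then have sm: "summable (\<lambda>n. mangoldt (Suc n) * real (Suc n) powr (-x))"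
    unfolding norm_mult norm_nat_powr norm_mangoldt by simp
  show ?thesis unfolding mangoldt_series_def
  proof (rule norm_suminf_le[OF _ sm])
    fix n
    show "norm (mangoldt (Suc n) * of_nat (Suc n) powr (-s) :: complex) \<le> mangoldt (Suc n) * real (Suc n) powr (-x)"
      unfolding norm_mult norm_nat_powr norm_mangoldt
      using assms by (intro mult_left_mono powr_mono mangoldt_nonneg) auto
  qed
qed

text \<open>To the right of the line, a zero would be a pole of \<open>mangoldt_series\<close>, which is however bounded by its
  value on the real axis. This avoids the Euler product.\<close>
lemma zeta_reg_nonzero_gt_1:
  assumes s: "Re s > 1"
  shows "zeta_reg s \<noteq> 0"
proof
  assume "zeta_reg s = 0"
  then obtain m :: nat where m: "m > 0"
    "((\<lambda>x. of_real x * (deriv zeta_reg (s + of_real x) / zeta_reg (s + of_real x))) \<longlongrightarrow> of_nat m) (at_right 0)"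
    using zeta_reg_logderiv_limit[of s] s by (metis (no_types, lifting) less_trans neq0_conv zero_less_one)
  define K where "K = (\<Sum>n. mangoldt (Suc n) * real (Suc n) powr (-Re s))"
  \<comment> \<open>The logarithmic derivative stays bounded along the horizontal ray from \<open>s\<close>.\<close>
  have bd: "((\<lambda>x. complex_of_real x * (1 / (s + of_real x - 1) - mangoldt_series (s + of_real x))) \<longlongrightarrow> 0) (at_right 0)"
  proof (rule Lim_null_comparison)
    show "\<forall>\<^sub>F x in at_right 0. norm (complex_of_real x * (1 / (s + of_real x - 1) - mangoldt_series (s + of_real x)))
       \<le> x * (1 / (Re s - 1) + K)"
      unfolding eventually_at_filter
    proof (intro always_eventually allI impI)
      fix x :: real assume "x \<noteq> 0" "x \<in> {0<..}"
      then have x: "x > 0" by simp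
      have "Re s - 1 \<le> norm (s + of_real x - 1)"
        using complex_Re_le_cmod[of "s + of_real x - 1"] x by simp
      then have "norm (1 / (s + of_real x - 1)) \<le> 1 / (Re s - 1)"
        unfolding norm_divide using s by (simp add: frac_le)
      moreover have "norm (mangoldt_series (s + of_real x)) \<le> K"
        unfolding K_def by (rule norm_mangoldt_series_le) (use s x in auto)
      ultimately show "norm (complex_of_real x * (1 / (s + of_real x - 1) - mangoldt_series (s + of_real x)))
          \<le> x * (1 / (Re s - 1) + K)"
        unfolding norm_mult using x
        by (intro mult_mono order_trans[OF norm_triangle_ineq4] add_mono) auto
    qed
    have "((\<lambda>x. x * (1 / (Re s - 1) + K)) \<longlongrightarrow> 0 * (1 / (Re s - 1) + K)) (at_right 0)"
      by (intro tendsto_intros)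
    then show "((\<lambda>x. x * (1 / (Re s - 1) + K)) \<longlongrightarrow> 0) (at_right 0)" by simp
  qed
  \<comment> \<open>A nonzero quotient has a nonzero denominator, because \<open>a / 0 = 0\<close>. So the limit also shows that the zero is isolated on the ray.\<close>
  have "\<forall>\<^sub>F x in at_right 0. of_real x * (deriv zeta_reg (s + of_real x) / zeta_reg (s + of_real x)) \<noteq> 0"
    using tendsto_imp_eventually_ne[OF m(2), of 0] m(1) by simp
  then have "\<forall>\<^sub>F x in at_right 0. complex_of_real x * (1 / (s + of_real x - 1) - mangoldt_series (s + of_real x)) =
     of_real x * (deriv zeta_reg (s + of_real x) / zeta_reg (s + of_real x))"
    using eventually_at_right_less[of 0]
  proof eventually_elim
    case (elim x)
    then have "zeta_reg (s + of_real x) \<noteq> 0" by auto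
    then show ?case using zeta_reg_logderiv[of "s + of_real x"] elim s by simp
  qed
  then have "((\<lambda>x. of_real x * (deriv zeta_reg (s + of_real x) / zeta_reg (s + of_real x))) \<longlongrightarrow> 0) (at_right 0)"
    using bd by (rule Lim_transform_eventually[rotated])
  from tendsto_unique[OF _ m(2) this] m(1) show False by simp
qed

text \<open>Approaching \<open>1 + it\<close> horizontally, \<open>mangoldt_series\<close> has residue 1 from the pole of zeta
  at \<open>t = 0\<close>, minus the order \<open>m\<close> of a zero.\<close>
lemma mangoldt_series_limit:
  fixes t :: real
  obtains m :: nat where "m = 0 \<longleftrightarrow> zeta_reg (1 + \<i> * t) \<noteq> 0"
    "((\<lambda>x. x * Re (mangoldt_series (1 + \<i> * t + of_real x))) \<longlongrightarrow> (if t = 0 then 1 else 0) - real m) (at_right 0)"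
proof -
  let ?s = "1 + \<i> * complex_of_real t"
  obtain m :: nat where m: "m = 0 \<longleftrightarrow> zeta_reg ?s \<noteq> 0"
    "((\<lambda>x. of_real x * (deriv zeta_reg (?s + of_real x) / zeta_reg (?s + of_real x))) \<longlongrightarrow> of_nat m) (at_right 0)"
  proof (rule zeta_reg_logderiv_limit[of ?s])
    show "Re ?s > 0" by simp
  qed
  have pole: "((\<lambda>x. complex_of_real x * (1 / (?s + of_real x - 1))) \<longlongrightarrow> (if t = 0 then 1 else 0)) (at_right 0)"
  proof (cases "t = 0")
    case True
    have "((\<lambda>x. 1) \<longlongrightarrow> (1::complex)) (at_right (0::real))" by simp
    then have "((\<lambda>x. complex_of_real x * (1 / (?s + of_real x - 1))) \<longlongrightarrow> 1) (at_right 0)"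
      by (rule Lim_transform_eventually) (use True in \<open>auto simp: eventually_at_filter\<close>)
    then show ?thesis using True by simp
  next
    case False
    have "((\<lambda>x. complex_of_real x * (1 / (?s + of_real x - 1))) \<longlongrightarrow> of_real 0 * (1 / (?s + of_real 0 - 1))) (at_right 0)"
      by (intro tendsto_intros) (use False in auto)
    then show ?thesis using False by simp
  qed
  have "((\<lambda>x. complex_of_real x * mangoldt_series (?s + of_real x)) \<longlongrightarrow> (if t = 0 then 1 else 0) - of_nat m) (at_right 0)"
  proof (rule Lim_transform_eventually[OF tendsto_diff[OF pole m(2)]])
    show "\<forall>\<^sub>F x in at_right 0. complex_of_real x * (1 / (?s + of_real x - 1)) -
        of_real x * (deriv zeta_reg (?s + of_real x) / zeta_reg (?s + of_real x)) =
        complex_of_real x * mangoldt_series (?s + of_real x)"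
      using eventually_at_right_less[of 0]
    proof eventually_elim
      case (elim x)
      then have gt: "Re (?s + of_real x) > 1" by simp
      show ?case unfolding zeta_reg_logderiv[OF gt zeta_reg_nonzero_gt_1[OF gt]]
        by (rule right_diff_distrib[symmetric])
    qed
  qed
  from tendsto_Re[OF this] have "((\<lambda>x. x * Re (mangoldt_series (?s + of_real x))) \<longlongrightarrow> (if t = 0 then 1 else 0) - real m) (at_right 0)"
    by (cases "t = 0") simp_all
  then show thesis by (rule that[OF m(1)])
qed

lemma Re_mangoldt_series:
  assumes "x > 0"
  shows "(\<lambda>n. mangoldt (Suc n) * real (Suc n) powr (-1 - x) * cos (t * ln (real (Suc n))))
    sums Re (mangoldt_series (1 + \<i> * of_real t + of_real x))" 
proof -
  let ?s = "1 + \<i> * complex_of_real t + of_real x"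
  have "(\<lambda>n. mangoldt (Suc n) * of_nat (Suc n) powr (-?s)) sums mangoldt_series ?s"
    unfolding mangoldt_series_def
    by (intro summable_sums summable_norm_cancel[OF summable_mangoldt_powr]) (use assms in auto)
  from sums_Re[OF this] have "(\<lambda>n. Re (mangoldt (Suc n) * of_nat (Suc n) powr (-?s))) sums Re (mangoldt_series ?s)" .
  moreover have "Re (mangoldt (Suc n) * of_nat (Suc n) powr (-?s)) =
     mangoldt (Suc n) * real (Suc n) powr (-1 - x) * cos (t * ln (real (Suc n)))" for n
  proof -
    define l where "l = ln (real (Suc n))"
    have lnc: "Ln (of_nat (Suc n)) = complex_of_real l"
      unfolding l_def by (metis Ln_of_real of_nat_0_less_iff of_real_of_nat_eq zero_less_Suc)
    have "of_nat (Suc n) powr (-?s) = exp (-?s * of_real l)"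
      unfolding powr_def using lnc by (simp del: of_nat_Suc)
    also have "Re \<dots> = exp ((-1 - x) * l) * cos (t * l)"
      by (simp add: Re_exp algebra_simps)
    also have "exp ((-1 - x) * l) = real (Suc n) powr (-1 - x)"
      unfolding powr_def l_def by simp
    finally have "Re (of_nat (Suc n) powr (-?s)) = real (Suc n) powr (-1 - x) * cos (t * l)" .
    then show ?thesis by (simp add: l_def del: of_nat_Suc)
  qed
  ultimately show ?thesis by (simp only:)
qed

text \<open>The argument of de la Vallee Poussin in the form of Mertens. The coefficients of \<open>mangoldt_series\<close> are
  nonnegative and \<open>3 + 4 * cos \<theta> + cos (2 * \<theta>) = 2 * (1 + cos \<theta>)^2 \<ge> 0\<close>. Combining the residues at \<open>1\<close>,
  \<open>1 + it\<close> and \<open>1 + 2it\<close> with these weights gives \<open>3 - 4 * m1 - m2 \<ge> 0\<close> for the orders \<open>m1\<close>, \<open>m2\<close> of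
  possible zeros, and hence \<open>m1 = 0\<close>.\<close>
lemma zeta_reg_nonzero:
  assumes s: "Re s \<ge> 1"
  shows "zeta_reg s \<noteq> 0"
proof (cases "Re s > 1")
  case False
  define t where "t = Im s"
  have st: "s = 1 + \<i> * of_real t" using s False by (simp add: complex_eq_iff t_def)
  show ?thesis
  proof (cases "t = 0")
    case True
    then show ?thesis using st zeta_reg_1 by simp
  next
    case t: False
    obtain m0 :: nat where m0: "m0 = 0 \<longleftrightarrow> zeta_reg (1 + \<i> * of_real 0) \<noteq> 0"
      "((\<lambda>x. x * Re (mangoldt_series (1 + \<i> * of_real 0 + of_real x))) \<longlongrightarrow> (if 0 = (0::real) then 1 else 0) - real m0) (at_right 0)"
      by (rule mangoldt_series_limit[of 0])
    obtain m1 :: nat where m1: "m1 = 0 \<longleftrightarrow> zeta_reg (1 + \<i> * of_real t) \<noteq> 0"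
      "((\<lambda>x. x * Re (mangoldt_series (1 + \<i> * of_real t + of_real x))) \<longlongrightarrow> (if t = 0 then 1 else 0) - real m1) (at_right 0)"
      by (rule mangoldt_series_limit[of t])
    obtain m2 :: nat where m2: "m2 = 0 \<longleftrightarrow> zeta_reg (1 + \<i> * of_real (2 * t)) \<noteq> 0"
      "((\<lambda>x. x * Re (mangoldt_series (1 + \<i> * of_real (2 * t) + of_real x))) \<longlongrightarrow> (if 2 * t = 0 then 1 else 0) - real m2) (at_right 0)"
      by (rule mangoldt_series_limit[of "2 * t"])
    define P where "P x = 3 * (x * Re (mangoldt_series (1 + \<i> * of_real 0 + of_real x)))
      + 4 * (x * Re (mangoldt_series (1 + \<i> * of_real t + of_real x)))
      + x * Re (mangoldt_series (1 + \<i> * of_real (2 * t) + of_real x))" for x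
    have lim: "(P \<longlongrightarrow> 3 * 1 + 4 * (0 - real m1) + (0 - real m2)) (at_right 0)"
      unfolding P_def using m0 m1(2) m2(2) t zeta_reg_1 by (intro tendsto_intros) auto
    have "\<forall>\<^sub>F x in at_right 0. 0 \<le> P x"
      using eventually_at_right_less[of 0]
    proof eventually_elim
      case (elim x)
      let ?a = "\<lambda>n. mangoldt (Suc n) * real (Suc n) powr (-1 - x)" 
      let ?c = "\<lambda>t n. ?a n * cos (t * ln (real (Suc n)))"
      note R = Re_mangoldt_series[OF elim]
      have "(\<lambda>n. 3 * ?c 0 n + 4 * ?c t n + ?c (2 * t) n) sums
         (3 * Re (mangoldt_series (1 + \<i> * of_real 0 + of_real x)) + 4 * Re (mangoldt_series (1 + \<i> * of_real t + of_real x))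
          + Re (mangoldt_series (1 + \<i> * of_real (2 * t) + of_real x)))"
        by (intro sums_add sums_mult R)
      moreover have "0 \<le> 3 * ?c 0 n + 4 * ?c t n + ?c (2 * t) n" for n
      proof -
        define \<theta> where "\<theta> = t * ln (real (Suc n))"
        have "3 * ?c 0 n + 4 * ?c t n + ?c (2 * t) n = ?a n * (3 + 4 * cos \<theta> + cos (2 * \<theta>))"
          by (simp add: \<theta>_def algebra_simps del: of_nat_Suc)
        also have "3 + 4 * cos \<theta> + cos (2 * \<theta>) = 2 * (1 + cos \<theta>)^2"
          using cos_double_cos[of \<theta>] by (simp add: power2_eq_square algebra_simps)
        finally show ?thesis using mangoldt_nonneg[of "Suc n"] by (simp del: of_nat_Suc)
      qed
      ultimately have "0 \<le> 3 * Re (mangoldt_series (1 + \<i> * of_real 0 + of_real x)) + 4 * Re (mangoldt_series (1 + \<i> * of_real t + of_real x))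
          + Re (mangoldt_series (1 + \<i> * of_real (2 * t) + of_real x))"
        by (rule sums_le[OF _ sums_zero, rotated])
      then have "0 \<le> x * (3 * Re (mangoldt_series (1 + \<i> * of_real 0 + of_real x)) + 4 * Re (mangoldt_series (1 + \<i> * of_real t + of_real x))
          + Re (mangoldt_series (1 + \<i> * of_real (2 * t) + of_real x)))"
        using elim by (intro mult_nonneg_nonneg) auto
      then show ?case unfolding P_def by (simp add: algebra_simps)
    qed
    then have "0 \<le> 3 * 1 + 4 * (0 - real m1) + (0 - real m2)"
      by (intro tendsto_lowerbound[OF lim]) auto
    then have "m1 = 0" by simp
    then show ?thesis using m1(1) st by simp
  qed
qed (use zeta_reg_nonzero_gt_1 in auto)

section \<open>The Chebyshev function\<close>

definition chebyshev_psi :: "nat \<Rightarrow> real" where "chebyshev_psi n = (\<Sum>k=1..n. mangoldt k)"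

lemma psi_0 [simp]: "chebyshev_psi 0 = 0" by (simp add: chebyshev_psi_def)

lemma psi_Suc: "chebyshev_psi (Suc n) = chebyshev_psi n + mangoldt (Suc n)" by (simp add: chebyshev_psi_def)

lemma psi_mono: "m \<le> n \<Longrightarrow> chebyshev_psi m \<le> chebyshev_psi n"
  unfolding chebyshev_psi_def by (intro sum_mono2) (auto simp: mangoldt_nonneg)

lemma psi_nonneg: "chebyshev_psi n \<ge> 0"
  using psi_mono[of 0 n] by simp

lemma card_multiples:
  fixes d n :: nat
  assumes "d > 0"
  shows "card {j\<in>{1..n}. d dvd j} = n div d"
proof -
  have "{j\<in>{1..n}. d dvd j} = (\<lambda>k. d * k) ` {1..n div d}"
  proof (intro equalityI subsetI)
    fix j assume "j \<in> {j\<in>{1..n}. d dvd j}"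
    then obtain k where "j = d * k" "1 \<le> j" "j \<le> n" by auto
    then show "j \<in> (\<lambda>k. d * k) ` {1..n div d}"
      using assms by (auto simp: less_eq_div_iff_mult_less_eq mult.commute)
  qed (use assms in \<open>auto simp: less_eq_div_iff_mult_less_eq mult.commute\<close>)
  also have "card \<dots> = n div d"
    using assms by (subst card_image) (auto simp: inj_on_def)
  finally show ?thesis .
qed

text \<open>Legendre's formula. The upper limit \<open>N\<close> may exceed \<open>n\<close>, since \<open>n div d = 0\<close> there. This lets the formulas
  for \<open>2 * m\<close> and \<open>m\<close> be subtracted term by term.\<close>
lemma ln_fact_eq_sum_mangoldt:
  assumes "n \<le> N"
  shows "ln (fact n) = (\<Sum>d=1..N. mangoldt d * real (n div d))"
proof -
  have "ln (fact n) = (\<Sum>j=1..n. ln (real j))"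
    unfolding fact_prod of_nat_prod by (subst ln_prod) auto
  also have "\<dots> = (\<Sum>j=1..n. \<Sum>d | d dvd j. mangoldt d)"
    using mangoldt_sum[where ?'a = real] by (intro sum.cong) auto
  also have "\<dots> = (\<Sum>j=1..n. \<Sum>d\<in>{1..N}. if d dvd j then mangoldt d else 0)"
  proof (rule sum.cong[OF refl])
    fix j assume j: "j \<in> {1..n}"
    have eq: "{d. d dvd j} = {d\<in>{1..N}. d dvd j}"
      using j assms by (auto dest: dvd_imp_le intro!: Nat.gr0I)
    show "(\<Sum>d | d dvd j. mangoldt d) = (\<Sum>d\<in>{1..N}. if d dvd j then mangoldt d else (0::real))"
      unfolding eq by (rule sum.inter_filter) simp
  qed
  also have "\<dots> = (\<Sum>d=1..N. \<Sum>j=1..n. if d dvd j then mangoldt d else 0)"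
    by (rule sum.swap)
  also have "\<dots> = (\<Sum>d=1..N. mangoldt d * real (n div d))"
  proof (intro sum.cong refl)
    fix d assume d: "d \<in> {1..N}"
    have "(\<Sum>j=1..n. if d dvd j then mangoldt d else (0::real)) = (\<Sum>j\<in>{j\<in>{1..n}. d dvd j}. mangoldt d)"
      by (rule sum.inter_filter[symmetric]) simp
    also have "\<dots> = mangoldt d * real (n div d)"
      using card_multiples[of d n] d by simp
    finally show "(\<Sum>j=1..n. if d dvd j then mangoldt d else (0::real)) = mangoldt d * real (n div d)" .
  qed
  finally show ?thesis .
qed

text \<open>Chebyshev's argument: in \<open>ln ((2 * m) choose m) = ln (fact (2 * m)) - 2 * ln (fact m)\<close> the coefficient of
  \<open>mangoldt d\<close> is \<open>(2 * m) div d - 2 * (m div d)\<close>. It is nonnegative, and it is 1 for \<open>m < d \<le> 2 * m\<close>.\<close>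
lemma psi_double: "chebyshev_psi (2 * m) - chebyshev_psi m \<le> 2 * m * ln 2"
proof -
  have "chebyshev_psi (2 * m) - chebyshev_psi m = (\<Sum>d\<in>{1..2*m} - {1..m}. mangoldt d)"
    unfolding chebyshev_psi_def by (subst sum_diff) auto
  also have "\<dots> \<le> (\<Sum>d\<in>{1..2*m} - {1..m}. mangoldt d * (real ((2 * m) div d) - 2 * real (m div d)))"
  proof (rule sum_mono)
    fix d assume d: "d \<in> {1..2*m} - {1..m}"
    then have "m div d = 0" "(2 * m) div d \<ge> 1" by (auto simp: less_eq_div_iff_mult_less_eq)
    then show "mangoldt d \<le> mangoldt d * (real ((2 * m) div d) - 2 * real (m div d))"
      using mult_left_mono[of 1 "real ((2 * m) div d)" "mangoldt d"] mangoldt_nonneg[of d] by simp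
  qed
  also have "\<dots> \<le> (\<Sum>d\<in>{1..2*m}. mangoldt d * (real ((2 * m) div d) - 2 * real (m div d)))"
  proof (intro sum_mono2)
    fix d assume d: "d \<in> {1..2*m} - ({1..2*m} - {1..m})"
    have "2 * (m div d) \<le> (2 * m) div d"
      using d by (auto simp: less_eq_div_iff_mult_less_eq)
    then have "2 * real (m div d) \<le> real ((2 * m) div d)"
      by (metis of_nat_le_iff of_nat_mult of_nat_numeral)
    then show "0 \<le> mangoldt d * (real ((2 * m) div d) - 2 * real (m div d))"
      using mangoldt_nonneg[of d] by simp
  qed auto
  also have "\<dots> = ln (fact (2 * m)) - 2 * ln (fact m)"
    using ln_fact_eq_sum_mangoldt[of "2*m" "2*m"] ln_fact_eq_sum_mangoldt[of m "2*m"]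
    by (simp add: right_diff_distrib sum_subtractf sum_distrib_left mult_ac)
  also have "\<dots> = ln (real ((2 * m) choose m))"
  proof -
    have "2 * m - m = m" by simp
    then have "real ((2 * m) choose m) = fact (2 * m) / (fact m * fact m)"
      using binomial_fact[of m "2 * m", where ?'a = real] by simp
    then have "ln (real ((2 * m) choose m)) = ln (fact (2 * m)) - ln (fact m * fact m)"
      by (simp add: ln_div)
    also have "ln (fact m * fact m :: real) = 2 * ln (fact m)"
      by (simp add: ln_mult)
    finally show ?thesis by simp
  qed
  also have "\<dots> \<le> ln (2 ^ (2 * m))"
  proof -
    have "(2 * m) choose m \<le> (\<Sum>k\<le>2*m. (2 * m) choose k)"
      by (rule member_le_sum) auto
    then have "(2 * m) choose m \<le> 2 ^ (2 * m)" by (simp add: choose_row_sum)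
    then have "real ((2 * m) choose m) \<le> 2 ^ (2 * m)"
      by (metis of_nat_le_iff of_nat_numeral of_nat_power)
    then show ?thesis by (intro ln_mono) auto
  qed
  also have "\<dots> = 2 * m * ln 2" by (simp add: ln_realpow)
  finally show ?thesis by simp
qed

lemma psi_le: "chebyshev_psi n \<le> 4 * real n"
proof (induction n rule: less_induct)
  case (less n)
  define m where "m = n div 2"
  show ?case
  proof (cases "n = 0")
    case False
    have "m < n" using False by (simp add: m_def)
    have ln2: "ln (2::real) \<le> 1" using ln_le_minus_one[of "2::real"] by simp
    have "chebyshev_psi (2 * m) \<le> chebyshev_psi m + 2 * m * ln 2" using psi_double[of m] by simp
    also have "\<dots> \<le> 4 * real m + 2 * m"
      using less[OF \<open>m < n\<close>] mult_left_mono[OF ln2, of "real m"] by simp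
    finally have *: "chebyshev_psi (2 * m) \<le> 6 * real m" by simp
    consider "n = 2 * m" | "n = Suc (2 * m)" unfolding m_def by linarith
    then show ?thesis
    proof cases
      case 2
      have "mangoldt n \<le> ln (real n)" using False by (intro mangoldt_le) auto
      also have "\<dots> \<le> real n - 1" using False by (intro ln_le_minus_one) auto
      finally have "mangoldt n \<le> 2 * real m" using 2 by simp
      then show ?thesis using * 2 psi_Suc[of "2 * m"] by simp
    qed (use * in simp)
  qed simp
qed

lemma abs_psi_minus_le: "\<bar>chebyshev_psi n - real n\<bar> \<le> 5 * real n"
  using psi_le[of n] psi_nonneg[of n] by linarith

lemma summation_by_parts:
  fixes a b :: "nat \<Rightarrow> complex"
  shows "(\<Sum>n<N. a n * b n) = (\<Sum>k<N. a k) * b N + (\<Sum>n<N. (\<Sum>k<Suc n. a k) * (b n - b (Suc n)))"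
  by (induction N) (simp_all add: algebra_simps)

lemma sum_mangoldt_minus_one: "(\<Sum>k<N. mangoldt (Suc k) - 1 :: complex) = of_real (chebyshev_psi N - real N)"
  by (induction N) (simp_all add: psi_Suc)

text \<open>Summation by parts turns the coefficients \<open>mangoldt n - 1\<close> into the partial sums
  \<open>chebyshev_psi n - n\<close>. The boundary term vanishes for \<open>Re s > 1\<close> by Chebyshev's bound.\<close>
lemma psi_abel:
  assumes s: "Re s > 1"
  shows "(\<lambda>n. of_real (chebyshev_psi (Suc n) - real (Suc n)) * (of_nat (Suc n) powr (-s) - of_nat (Suc (Suc n)) powr (-s)))
     sums (mangoldt_series s - zeta_series s)"
proof -
  let ?b = "\<lambda>n. of_nat (Suc n) powr (-s) :: complex"
  have "(\<lambda>n. mangoldt (Suc n) * ?b n - ?b n) sums (mangoldt_series s - zeta_series s)"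
    unfolding mangoldt_series_def zeta_series_def
    by (intro sums_diff summable_sums summable_norm_cancel[OF summable_mangoldt_powr[OF s]]
         summable_norm_cancel[OF summable_nat_powr[OF s]])
  then have "(\<lambda>N. \<Sum>n<N. (mangoldt (Suc n) - 1) * ?b n) \<longlonglongrightarrow> mangoldt_series s - zeta_series s"
    by (simp add: sums_def left_diff_distrib)
  moreover have "(\<lambda>N. (\<Sum>k<N. mangoldt (Suc k) - 1) * ?b N) \<longlonglongrightarrow> 0"
  proof (rule Lim_null_comparison)
    show "\<forall>\<^sub>F N in sequentially. norm ((\<Sum>k<N. mangoldt (Suc k) - 1) * ?b N) \<le> 5 * real (Suc N) powr (1 - Re s)"
    proof (intro always_eventually allI)
      fix N
      have "norm ((\<Sum>k<N. mangoldt (Suc k) - 1) * ?b N) = \<bar>chebyshev_psi N - real N\<bar> * real (Suc N) powr (-Re s)"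
        unfolding sum_mangoldt_minus_one norm_mult norm_nat_powr norm_of_real uminus_complex.sel ..
      also have "\<dots> \<le> (5 * real (Suc N)) * real (Suc N) powr (-Re s)"
        using abs_psi_minus_le[of N] by (intro mult_right_mono) auto
      also have "\<dots> = 5 * (real (Suc N) powr 1 * real (Suc N) powr (-Re s))" by simp
      also have "\<dots> = 5 * real (Suc N) powr (1 - Re s)"
        unfolding powr_add[symmetric] by simp
      finally show "norm ((\<Sum>k<N. mangoldt (Suc k) - 1) * ?b N) \<le> 5 * real (Suc N) powr (1 - Re s)" .
    qed
    have "(\<lambda>N. 5 * real (Suc N) powr (1 - Re s)) \<longlonglongrightarrow> 5 * 0"
      by (intro tendsto_intros tendsto_neg_powr filterlim_compose[OF filterlim_real_sequentially] filterlim_Suc) (use s in auto)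
    then show "(\<lambda>N. 5 * real (Suc N) powr (1 - Re s)) \<longlonglongrightarrow> 0" by simp
  qed
  ultimately have "(\<lambda>N. (\<Sum>n<N. (mangoldt (Suc n) - 1) * ?b n) - (\<Sum>k<N. mangoldt (Suc k) - 1) * ?b N)
     \<longlonglongrightarrow> (mangoldt_series s - zeta_series s) - 0"
    by (rule tendsto_diff)
  then have "(\<lambda>N. \<Sum>n<N. (\<Sum>k<Suc n. mangoldt (Suc k) - 1) * (?b n - ?b (Suc n))) \<longlonglongrightarrow> mangoldt_series s - zeta_series s"
    by (subst (asm) summation_by_parts) simp
  then show ?thesis unfolding sum_mangoldt_minus_one sums_def .
qed

text \<open>Newman's theorem is applied to \<open>c n = (chebyshev_psi k - k) / k\<close> with \<open>k = n + 1\<close>, bounded by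
  Chebyshev. By summation by parts, \<open>s\<close> times its Dirichlet series at \<open>s = 1 + z\<close> is
  \<open>mangoldt_series s - zeta_series s\<close> up to an error \<open>R\<close> that is holomorphic for \<open>Re s > 0\<close>. Written through
  \<open>zeta_reg\<close>, the poles at 1 of the two series cancel, and the zero-free closed half plane provides the
  continuation.\<close>
lemma summable_psi_minus_id: "summable (\<lambda>n. (chebyshev_psi (Suc n) - real (Suc n)) / (real (Suc n))^2)"
proof -
  define A where "A n = chebyshev_psi (Suc n) - real (Suc n)" for n
  have A: "\<bar>A n\<bar> \<le> 5 * real (Suc n)" for n unfolding A_def by (rule abs_psi_minus_le)
  \<comment> \<open>The error of replacing \<open>k powr (-s) - (k + 1) powr (-s)\<close> by \<open>s * k powr (-s - 1)\<close>.\<close>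
  define r where "r n s = of_nat (Suc (Suc n)) powr (-s) - of_nat (Suc n) powr (-s) - (-s) * of_nat (Suc n) powr (-s - 1)"
    for n and s :: complex
  define R where "R s = (\<Sum>n. of_real (A n) * r n s)" for s
  have hol: "(\<lambda>s. of_real (A n) * r n s) holomorphic_on UNIV" for n
    unfolding r_def by (intro holomorphic_intros)
  have der: "((\<lambda>s. of_real (A n) * r n s) has_field_derivative deriv (\<lambda>s. of_real (A n) * r n s) s) (at s)" for n s
    using holomorphic_derivI[OF hol open_UNIV] by simp
  have bound: "norm (of_real (A n) * r n s) \<le> (5 * norm s * norm (s + 1)) * real (Suc n) powr (-1 - (Re s - 0))"
    if "Re s > 0" for n s
  proof -
    have "norm (r n s) \<le> norm (-s) * norm (-s - 1) * real (Suc n) powr (Re (-s) - 2)"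
      unfolding r_def by (rule powr_second_difference) (use that in auto)
    also have "norm (-s - 1) = norm (s + 1)"
      by (metis minus_add_distrib norm_minus_cancel uminus_add_conv_diff add.commute)
    finally have r: "norm (r n s) \<le> norm s * norm (s + 1) * real (Suc n) powr (-Re s - 2)" by simp
    have "norm (of_real (A n) * r n s) \<le> (5 * real (Suc n)) * (norm s * norm (s + 1) * real (Suc n) powr (-Re s - 2))"
      unfolding norm_mult norm_of_real by (intro mult_mono A r) auto
    also have "\<dots> = 5 * norm s * norm (s + 1) * (real (Suc n) powr 1 * real (Suc n) powr (-Re s - 2))" by simp
    also have "real (Suc n) powr 1 * real (Suc n) powr (-Re s - 2) = real (Suc n) powr (-1 - (Re s - 0))"
      unfolding powr_add[symmetric] by (simp add: algebra_simps)
    finally show ?thesis .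
  qed
  have cont: "continuous_on UNIV (\<lambda>s::complex. 5 * norm s * norm (s + 1))"
    by (intro continuous_intros)
  note hp = half_plane_series[where a = 0 and f = "\<lambda>n s. of_real (A n) * r n s", OF der bound cont]
  have holR: "R holomorphic_on {s. Re s > 0}" unfolding R_def by (rule hp(2))
  have sumR: "(\<lambda>n. of_real (A n) * r n s) sums R s" if "Re s > 0" for s
    unfolding R_def by (intro summable_sums hp(1) that)

  \<comment> \<open>The difference quotient of \<open>zeta_reg\<close> at 1 is zeta without its pole.\<close>
  define Q where "Q s = (if s = 1 then deriv zeta_reg 1 else (zeta_reg s - zeta_reg 1) / (s - 1))" for s
  have holQ: "Q holomorphic_on {s. Re s > 0}"
    unfolding Q_def by (intro pole_lemma_open zeta_reg_holomorphic open_halfspace_Re_gt)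
  define V where "V = {s. Re s > 0} \<inter> zeta_reg -` (- {0})"
  have V: "open V" unfolding V_def
    by (intro continuous_open_preimage holomorphic_on_imp_continuous_on zeta_reg_holomorphic open_halfspace_Re_gt) auto
  define W where "W s = (- (deriv zeta_reg s / zeta_reg s) - Q s + R s) / s" for s
  have W: "W holomorphic_on V" unfolding W_def
    by (intro holomorphic_intros holomorphic_on_subset[OF holQ] holomorphic_on_subset[OF holR]
          holomorphic_on_subset[OF zeta_reg_holomorphic]
          holomorphic_on_subset[OF holomorphic_deriv[OF zeta_reg_holomorphic]] open_halfspace_Re_gt)
       (auto simp: V_def)
  define U where "U = (\<lambda>z. 1 + z) -` V"
  have U: "open U" unfolding U_def by (intro open_vimage V continuous_intros)
  have sub: "{z. Re z \<ge> 0} \<subseteq> U" using zeta_reg_nonzero by (auto simp: U_def V_def)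
  define F where "F z = W (1 + z)" for z
  have "(W \<circ> (\<lambda>z. 1 + z)) holomorphic_on U"
    by (rule holomorphic_on_compose_gen[OF _ W]) (auto simp: U_def intro!: holomorphic_intros)
  moreover have "W \<circ> (\<lambda>z. 1 + z) = F" by (simp add: fun_eq_iff F_def)
  ultimately have F: "F holomorphic_on U" by simp
  define c where "c n = complex_of_real (A n / real (Suc n))" for n
  have c: "norm (c n) \<le> 5" for n
    unfolding c_def norm_of_real using A[of n] by (simp add: abs_divide divide_le_eq)
  have sums: "(\<lambda>n. c n * of_nat (Suc n) powr (-1 - z)) sums F z" if z: "Re z > 0" for z
  proof -
    define s where "s = 1 + z"
    have s: "Re s > 1" using z by (simp add: s_def)
    then have s0: "s \<noteq> 0" "s \<noteq> 1" by auto
    have "(\<lambda>n. of_real (A n) * (of_nat (Suc n) powr (-s) - of_nat (Suc (Suc n)) powr (-s)) + of_real (A n) * r n s)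
        sums (mangoldt_series s - zeta_series s + R s)"
      unfolding A_def by (intro sums_add psi_abel s sumR[unfolded A_def]) (use s in auto)
    also have "(\<lambda>n. of_real (A n) * (of_nat (Suc n) powr (-s) - of_nat (Suc (Suc n)) powr (-s)) + of_real (A n) * r n s) =
        (\<lambda>n. s * (of_real (A n) * of_nat (Suc n) powr (-s - 1)))"
      by (simp add: r_def algebra_simps del: of_nat_Suc)
    finally have "(\<lambda>n. (s * (of_real (A n) * of_nat (Suc n) powr (-s - 1))) / s) sums
        ((mangoldt_series s - zeta_series s + R s) / s)" by (rule sums_divide)
    moreover have "(s * (of_real (A n) * of_nat (Suc n) powr (-s - 1))) / s = c n * of_nat (Suc n) powr (-1 - z)" for n
    proof -
      have "of_nat (Suc n) powr (-s - 1) = (of_nat (Suc n) powr (-s) / of_nat (Suc n) :: complex)"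
        by (subst powr_diff) (simp del: of_nat_Suc)
      moreover have "-1 - z = -s" by (simp add: s_def)
      ultimately show ?thesis using s0 by (simp add: c_def del: of_nat_Suc)
    qed
    moreover have "(mangoldt_series s - zeta_series s + R s) / s = F z"
    proof -
      have "mangoldt_series s = 1 / (s - 1) - deriv zeta_reg s / zeta_reg s"
        by (intro zeta_reg_logderiv s zeta_reg_nonzero_gt_1)
      moreover have "zeta_series s = zeta_reg s / (s - 1)"
        using zeta_reg_eq[OF s] s0 by simp
      moreover have "Q s = zeta_reg s / (s - 1) - 1 / (s - 1)"
        using s0 by (simp add: Q_def zeta_reg_1 diff_divide_distrib)
      ultimately show ?thesis unfolding F_def W_def s_def[symmetric] by simp
    qed
    ultimately show ?thesis by (simp only:)
  qed
  have "(\<lambda>n. c n / of_nat (Suc n)) sums F 0" by (rule newman[OF c F U sub sums])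
  then have "summable (\<lambda>n. Re (c n / of_nat (Suc n)))" by (intro summable_Re sums_summable)
  also have "(\<lambda>n. Re (c n / of_nat (Suc n))) = (\<lambda>n. (chebyshev_psi (Suc n) - real (Suc n)) / (real (Suc n))^2)"
    by (simp add: c_def A_def power2_eq_square Re_divide_of_nat del: of_nat_Suc)
  finally show ?thesis .
qed

text \<open>Convergence of the series forces \<open>chebyshev_psi n ~ n\<close> because \<open>chebyshev_psi\<close> increases. If it exceeds
  \<open>(1 + 2 * \<delta>) * N\<close> at \<open>N\<close>, then \<open>chebyshev_psi k - k \<ge> \<delta> * N\<close> for all \<open>k\<close> from \<open>N\<close> to \<open>(1 + \<delta>) * N\<close>. These
  \<open>k\<close> alone contribute \<open>\<delta>^2 / (1 + \<delta>)^2\<close> to the series, which contradicts Cauchy's criterion for large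
  \<open>N\<close>. A value below \<open>(1 - 2 * \<delta>) * N\<close> is excluded by the \<open>k\<close> from \<open>(1 - \<delta>) * N\<close> to \<open>N\<close>.\<close>
theorem psi_asymptotics: "(\<lambda>n. chebyshev_psi n / real n) \<longlonglongrightarrow> 1"
proof -
  define e where "e n = (chebyshev_psi (Suc n) - real (Suc n)) / (real (Suc n))^2" for n
  have bounds: "\<forall>\<^sub>F N in sequentially. chebyshev_psi N < (1 + 2 * \<delta>) * N \<and> chebyshev_psi N > (1 - 2 * \<delta>) * N"
    if \<delta>: "0 < \<delta>" "\<delta> \<le> 1/2" for \<delta> :: real
  proof -
    have pos: "\<delta>^2 / 4 > 0" using \<delta> by simp
    have "summable e" using summable_psi_minus_id unfolding e_def .
    from this[unfolded summable_Cauchy, rule_format, OF pos]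
    obtain N0 where N0: "\<And>m n. m \<ge> N0 \<Longrightarrow> \<bar>sum e {m..<n}\<bar> < \<delta>^2 / 4" by auto
    have "chebyshev_psi N < (1 + 2 * \<delta>) * N \<and> chebyshev_psi N > (1 - 2 * \<delta>) * N" if N: "N \<ge> 2 * N0 + 4" for N
    proof (rule ccontr)
      assume neg: "\<not> (chebyshev_psi N < (1 + 2 * \<delta>) * N \<and> chebyshev_psi N > (1 - 2 * \<delta>) * N)"
      define D where "D = nat \<lfloor>\<delta> * N\<rfloor>"
      have D: "real D \<le> \<delta> * N" "\<delta> * N \<le> real D + 1" using \<delta> by (simp_all add: D_def)
      have "\<delta> * N \<le> (1/2) * N" using \<delta> by (intro mult_right_mono) auto
      then have D2: "2 * D \<le> N" using D by linarith
      have Npos: "real N > 0" using N by simp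
      have nn: "0 \<le> \<delta> * real N" using \<delta> by simp
      show False
      proof (cases "chebyshev_psi N < (1 + 2 * \<delta>) * N")
        case False
        have "(\<delta> * N) * (\<delta> * N / ((1 + \<delta>) * N)^2) \<le> (\<Sum>n\<in>{N-1..<N+D}. \<delta> * N / ((1 + \<delta>) * N)^2)"
        proof -
          have "N + D - (N - 1) = D + 1" using N by linarith
          then show ?thesis
            using mult_right_mono[OF D(2), of "\<delta> * N / ((1 + \<delta>) * N)^2"] \<delta> by (simp add: add.commute)
        qed
        also have "\<dots> \<le> sum e {N-1..<N+D}"
        proof (rule sum_mono)
          fix n assume n: "n \<in> {N-1..<N+D}"
          have k: "real (Suc n) \<le> (1 + \<delta>) * N" using n D by (simp add: algebra_simps)
          have "chebyshev_psi N \<le> chebyshev_psi (Suc n)" using n by (intro psi_mono) auto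
          then have "\<delta> * N \<le> chebyshev_psi (Suc n) - real (Suc n)" using False k by (simp add: algebra_simps)
          moreover have "(real (Suc n))^2 \<le> ((1 + \<delta>) * N)^2" using k by (intro power_mono) auto
          ultimately show "\<delta> * N / ((1 + \<delta>) * N)^2 \<le> e n"
            unfolding e_def by - (rule frac_le[OF order_trans[OF nn]], auto)
        qed
        also have "\<dots> < \<delta>^2 / 4" using N0[of "N - 1" "N + D"] N by linarith
        finally have "(\<delta> * N) * (\<delta> * N / ((1 + \<delta>) * N)^2) < \<delta>^2 / 4" .
        moreover have "(\<delta> * N) * (\<delta> * N / ((1 + \<delta>) * N)^2) = \<delta>^2 / (1 + \<delta>)^2"
          using Npos by (simp add: power2_eq_square)
        moreover have "\<delta>^2 / 4 \<le> \<delta>^2 / (1 + \<delta>)^2"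
        proof -
          have "(1 + \<delta>)^2 \<le> 2^2" using \<delta> by (intro power_mono) auto
          then show ?thesis using \<delta> by (intro divide_left_mono) auto
        qed
        ultimately show False by linarith
      next
        case True
        then have le: "chebyshev_psi N \<le> (1 - 2 * \<delta>) * N" using neg by simp
        have "(\<delta> * N) * (\<delta> * N / (real N)^2) \<le> (\<Sum>n\<in>{N-D-1..<N}. \<delta> * N / (real N)^2)"
        proof -
          have "N - (N - D - 1) = D + 1" using D2 N by linarith
          then show ?thesis
            using mult_right_mono[OF D(2), of "\<delta> * N / (real N)^2"] \<delta> by (simp add: add.commute)
        qed
        also have "\<dots> \<le> (\<Sum>n\<in>{N-D-1..<N}. - e n)"
        proof (rule sum_mono)
          fix n assume n: "n \<in> {N-D-1..<N}"
          then have "real N - real D \<le> real (Suc n)" by (auto simp: of_nat_diff)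
          then have k: "(1 - \<delta>) * N \<le> real (Suc n)" using D by (simp add: algebra_simps)
          have "chebyshev_psi (Suc n) \<le> chebyshev_psi N" using n by (intro psi_mono) auto
          then have "\<delta> * N \<le> real (Suc n) - chebyshev_psi (Suc n)" using le k by (simp add: algebra_simps)
          moreover have "(real (Suc n))^2 \<le> (real N)^2" using n by (intro power_mono) auto
          ultimately have "\<delta> * N / (real N)^2 \<le> (real (Suc n) - chebyshev_psi (Suc n)) / (real (Suc n))^2"
            by - (rule frac_le[OF order_trans[OF nn]], auto)
          then show "\<delta> * N / (real N)^2 \<le> - e n"
            unfolding e_def by (simp only: minus_divide_left minus_diff_eq)
        qed
        also have "\<dots> = - sum e {N-D-1..<N}" by (rule sum_negf)
        also have "\<dots> < \<delta>^2 / 4" using N0[of "N - D - 1" N] N D2 by linarith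
        finally have "(\<delta> * N) * (\<delta> * N / (real N)^2) < \<delta>^2 / 4" .
        moreover have "(\<delta> * N) * (\<delta> * N / (real N)^2) = \<delta>^2"
          using Npos by (simp add: power2_eq_square)
        ultimately have "\<delta>^2 < \<delta>^2 / 4" by (simp only:)
        then show False using pos by linarith
      qed
    qed
    then show ?thesis by (auto simp: eventually_sequentially)
  qed
  show ?thesis unfolding tendsto_iff
  proof (intro allI impI)
    fix \<epsilon> :: real assume \<epsilon>: "\<epsilon> > 0"
    define \<delta> where "\<delta> = min (1/2) (\<epsilon> / 2)"
    have \<delta>: "0 < \<delta>" "\<delta> \<le> 1/2" "2 * \<delta> \<le> \<epsilon>" using \<epsilon> by (auto simp: \<delta>_def)
    show "\<forall>\<^sub>F n in sequentially. dist (chebyshev_psi n / real n) 1 < \<epsilon>"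
      using bounds[OF \<delta>(1,2)] eventually_gt_at_top[of 0]
    proof eventually_elim
      case (elim n)
      then have "chebyshev_psi n / n < 1 + 2 * \<delta>" "chebyshev_psi n / n > 1 - 2 * \<delta>"
        by (simp_all add: divide_less_eq less_divide_eq)
      then show ?case using \<delta>(3) by (simp add: dist_real_def abs_if)
    qed
  qed
qed

section \<open>The prime number theorem\<close>

definition primes_le :: "nat \<Rightarrow> nat set" where "primes_le n = {p. prime p \<and> p \<le> n}"

lemma finite_primes_le [simp]: "finite (primes_le n)"
  by (rule finite_subset[of _ "{..n}"]) (auto simp: primes_le_def)

text \<open>Grouping prime powers by their prime: the powers \<open>p ^ i \<le> n\<close> number at most \<open>ln n / ln p\<close>, each with
  weight \<open>ln p\<close>.\<close>
lemma psi_le_primes: "chebyshev_psi n \<le> real (card (primes_le n)) * ln (real n)"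
proof (cases "n = 0")
  case False
  define S where "S = {k\<in>{1..n}. primepow k}"
  have [simp]: "finite S" by (simp add: S_def)
  have ap: "\<exists>i>0. prime (aprimedivisor k) \<and> k = aprimedivisor k ^ i" if "k \<in> S" for k
    using that unfolding S_def primepow_def by (auto simp: aprimedivisor_prime_power)
  have img: "aprimedivisor ` S \<subseteq> primes_le n"
  proof
    fix p assume "p \<in> aprimedivisor ` S"
    then obtain k where k: "k \<in> S" "p = aprimedivisor k" by auto
    then have "p dvd k" "prime p" using ap[OF k(1)] by (metis dvd_power)+
    then show "p \<in> primes_le n" using k by (auto simp: S_def primes_le_def dest!: dvd_imp_le)
  qed
  have "chebyshev_psi n = (\<Sum>k\<in>S. ln (real (aprimedivisor k)))"
    unfolding chebyshev_psi_def S_def mangoldt_def sum.inter_filter[OF finite_atLeastAtMost] by (simp add: of_real_eq_id cong: if_cong)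
  also have "\<dots> = (\<Sum>p\<in>primes_le n. \<Sum>k\<in>{k\<in>S. aprimedivisor k = p}. ln (real (aprimedivisor k)))"
    by (rule sum.group[symmetric]) (use img in auto)
  also have "\<dots> \<le> (\<Sum>p\<in>primes_le n. ln (real n))"
  proof (rule sum_mono)
    fix p assume "p \<in> primes_le n"
    then have p: "prime p" by (simp add: primes_le_def)
    then have lnp: "ln (real p) > 0" using prime_gt_1_nat[OF p] by simp
    define M where "M = nat \<lfloor>ln (real n) / ln (real p)\<rfloor>"
    have "{k\<in>S. aprimedivisor k = p} \<subseteq> (\<lambda>i. p ^ i) ` {1..M}"
    proof
      fix k assume k: "k \<in> {k\<in>S. aprimedivisor k = p}"
      then obtain i where i: "i > 0" "k = p ^ i" using ap by blast
      have "p ^ i \<le> n" using k i by (auto simp: S_def)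
      then have "real p ^ i \<le> real n" by simp
      then have "ln (real p ^ i) \<le> ln (real n)"
        using prime_gt_0_nat[OF p] by (intro ln_mono) auto
      then have "real i * ln (real p) \<le> ln (real n)" using prime_gt_0_nat[OF p] by (simp add: ln_realpow)
      then have "real i \<le> ln (real n) / ln (real p)" using lnp by (simp add: le_divide_eq)
      then have "i \<le> M" unfolding M_def by linarith
      then show "k \<in> (\<lambda>i. p ^ i) ` {1..M}" using i by auto
    qed
    then have "card {k\<in>S. aprimedivisor k = p} \<le> card ((\<lambda>i. p ^ i) ` {1..M})"
      by (intro card_mono) auto
    also have "\<dots> \<le> M" using card_image_le[of "{1..M}" "\<lambda>i. p ^ i"] by simp
    finally have "card {k\<in>S. aprimedivisor k = p} \<le> M" .
    moreover have "real M \<le> ln (real n) / ln (real p)"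
      unfolding M_def using lnp False by (intro of_nat_floor) auto
    ultimately have "real (card {k\<in>S. aprimedivisor k = p}) \<le> ln (real n) / ln (real p)" by linarith
    then have "real (card {k\<in>S. aprimedivisor k = p}) * ln (real p) \<le> ln (real n)"
      using lnp by (simp add: le_divide_eq)
    then show "(\<Sum>k\<in>{k\<in>S. aprimedivisor k = p}. ln (real (aprimedivisor k))) \<le> ln (real n)" by simp
  qed
  finally show ?thesis by simp
qed simp

text \<open>Each prime in \<open>(y, n]\<close> contributes at least \<open>ln y\<close>.\<close>
lemma primes_le_psi:
  assumes "y \<ge> 1"
  shows "(real (card (primes_le n)) - y) * ln y \<le> chebyshev_psi n"
proof -
  define P where "P = {p\<in>primes_le n. real p > y}"
  have [simp]: "finite P" by (simp add: P_def)
  have "primes_le n \<subseteq> P \<union> {1..nat \<lfloor>y\<rfloor>}"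
    using assms by (auto simp: P_def primes_le_def prime_ge_Suc_0_nat le_nat_iff le_floor_iff)
  then have "card (primes_le n) \<le> card (P \<union> {1..nat \<lfloor>y\<rfloor>})" by (intro card_mono) auto
  also have "\<dots> \<le> card P + nat \<lfloor>y\<rfloor>" using card_Un_le[of P "{1..nat \<lfloor>y\<rfloor>}"] by simp
  finally have "real (card (primes_le n)) - y \<le> real (card P)" using assms by linarith
  then have "(real (card (primes_le n)) - y) * ln y \<le> (\<Sum>p\<in>P. ln y)"
    using assms by (simp add: mult_right_mono)
  also have "\<dots> \<le> (\<Sum>p\<in>P. mangoldt p)"
    using assms by (intro sum_mono) (auto simp: P_def primes_le_def intro!: ln_mono)
  also have "\<dots> \<le> chebyshev_psi n"
    unfolding chebyshev_psi_def by (intro sum_mono2) (auto simp: P_def primes_le_def mangoldt_nonneg prime_ge_Suc_0_nat)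
  finally show ?thesis .
qed

text \<open>The prime number theorem, squeezed between the two comparisons with \<open>chebyshev_psi\<close>.\<close>
theorem primes_le_asymptotics: "(\<lambda>n. real (card (primes_le n)) * ln (real n) / real n) \<longlonglongrightarrow> 1"
proof (rule tendsto_sandwich)
  \<comment> \<open>The cut must satisfy \<open>ln y ~ ln n\<close> and \<open>y = o(n / ln n)\<close>.\<close>
  define y where "y n = real n / ln (real n) ^ 2" for n :: nat
  have y1: "\<forall>\<^sub>F n in sequentially. y n > 1" unfolding y_def by real_asymp
  show "\<forall>\<^sub>F n in sequentially. chebyshev_psi n / real n \<le> real (card (primes_le n)) * ln (real n) / real n"
    using psi_le_primes by (intro always_eventually allI divide_right_mono) auto
  show "\<forall>\<^sub>F n in sequentially. real (card (primes_le n)) * ln (real n) / real n \<le>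
      (ln (real n) / ln (y n)) * (chebyshev_psi n / real n) + y n * ln (real n) / real n"
    using y1 eventually_gt_at_top[of 1]
  proof eventually_elim
    case (elim n)
    have ly: "ln (y n) > 0" using elim by simp
    have "(real (card (primes_le n)) - y n) * ln (y n) \<le> chebyshev_psi n" using elim by (intro primes_le_psi) auto
    then have "real (card (primes_le n)) \<le> chebyshev_psi n / ln (y n) + y n" using ly by (simp add: field_simps)
    then have "real (card (primes_le n)) * ln (real n) / real n \<le> (chebyshev_psi n / ln (y n) + y n) * ln (real n) / real n"
      using elim by (intro divide_right_mono mult_right_mono) auto
    then show ?case by (simp add: algebra_simps add_divide_distrib)
  qed
  show "(\<lambda>n. chebyshev_psi n / real n) \<longlonglongrightarrow> 1" by (rule psi_asymptotics)
  have "(\<lambda>n. ln (real n) / ln (y n)) \<longlonglongrightarrow> 1" unfolding y_def by real_asymp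
  moreover have "(\<lambda>n. y n * ln (real n) / real n) \<longlonglongrightarrow> 0" unfolding y_def by real_asymp
  ultimately have "(\<lambda>n. (ln (real n) / ln (y n)) * (chebyshev_psi n / real n) + y n * ln (real n) / real n) \<longlonglongrightarrow> 1 * 1 + 0"
    by (intro tendsto_intros psi_asymptotics)
  then show "(\<lambda>n. (ln (real n) / ln (y n)) * (chebyshev_psi n / real n) + y n * ln (real n) / real n) \<longlonglongrightarrow> 1" by simp
qed

text \<open>The strict inequality matches the definition of \<open>SP_count\<close>. A real argument is needed because
  the counting function of SP numbers samples it at \<open>x / a^2\<close>.\<close>
definition prime_count :: "real \<Rightarrow> nat" where
  "prime_count x = card {p. prime p \<and> real p < x}"

lemma finite_primes_less [simp]: "finite {p::nat. prime p \<and> real p < x}"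
  by (rule finite_subset[of _ "{..nat \<lceil>x\<rceil>}"]) (auto, linarith)

theorem prime_count_asymptotics: "((\<lambda>x. real (prime_count x) * ln x / x) \<longlongrightarrow> 1) at_top"
proof -
  define N where "N x = nat (\<lceil>x\<rceil> - 1)" for x :: real
  have pc: "prime_count x = card (primes_le (N x))" for x
  proof -
    have "real p < x \<longleftrightarrow> p \<le> N x" if "prime p" for p
      using prime_gt_0_nat[OF that] unfolding N_def by linarith
    then show ?thesis by (auto simp: prime_count_def primes_le_def intro!: arg_cong[where f = card])
  qed
  have N: "x - 1 \<le> real (N x)" "real (N x) \<le> x" if "x \<ge> 1" for x
    using that unfolding N_def by linarith+
  have Ntop: "filterlim N at_top at_top"
  proof -
    have "filterlim (\<lambda>x. real (N x)) at_top at_top"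
    proof (rule filterlim_at_top_mono)
      show "filterlim (\<lambda>x::real. x - 1) at_top at_top" by real_asymp
      show "\<forall>\<^sub>F x in at_top. x - 1 \<le> real (N x)"
        using eventually_ge_at_top[of 1] by eventually_elim (rule N)
    qed
    then show ?thesis by (simp add: filterlim_sequentially_iff_filterlim_real)
  qed
  have 1: "((\<lambda>x. real (card (primes_le (N x))) * ln (real (N x)) / real (N x)) \<longlongrightarrow> 1) at_top"
    by (rule filterlim_compose[OF primes_le_asymptotics Ntop])
  have 2: "((\<lambda>x. real (N x) / x) \<longlongrightarrow> 1) at_top"
  proof (rule tendsto_sandwich)
    show "\<forall>\<^sub>F x in at_top. (x - 1) / x \<le> real (N x) / x"
      using eventually_ge_at_top[of 1] by eventually_elim (auto intro!: divide_right_mono N)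
    show "\<forall>\<^sub>F x in at_top. real (N x) / x \<le> 1"
      using eventually_ge_at_top[of 1] by eventually_elim (auto simp: N)
    show "((\<lambda>x::real. (x - 1) / x) \<longlongrightarrow> 1) at_top" by real_asymp
  qed auto
  have 3: "((\<lambda>x. ln (real (N x)) / ln x) \<longlongrightarrow> 1) at_top"
  proof (rule tendsto_sandwich)
    show "\<forall>\<^sub>F x in at_top. ln (x - 1) / ln x \<le> ln (real (N x)) / ln x"
      using eventually_gt_at_top[of 2] by eventually_elim (auto intro!: divide_right_mono ln_mono N)
    show "\<forall>\<^sub>F x in at_top. ln (real (N x)) / ln x \<le> 1"
      using eventually_gt_at_top[of 2]
    proof eventually_elim
      case (elim x)
      then have "ln (real (N x)) \<le> ln x" using N[of x] by (intro ln_mono) auto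
      then show ?case using elim by simp
    qed
    show "((\<lambda>x::real. ln (x - 1) / ln x) \<longlongrightarrow> 1) at_top" by real_asymp
  qed auto
  have "((\<lambda>x. (real (card (primes_le (N x))) * ln (real (N x)) / real (N x)) * (real (N x) / x) / (ln (real (N x)) / ln x)) \<longlongrightarrow> 1 * 1 / 1) at_top"
    by (intro tendsto_intros 1 2 3) auto
  then have lim: "((\<lambda>x. (real (card (primes_le (N x))) * ln (real (N x)) / real (N x)) * (real (N x) / x) / (ln (real (N x)) / ln x)) \<longlongrightarrow> 1) at_top" by simp
  show ?thesis
  proof (rule Lim_transform_eventually[OF lim])
    show "\<forall>\<^sub>F x in at_top. (real (card (primes_le (N x))) * ln (real (N x)) / real (N x)) * (real (N x) / x) / (ln (real (N x)) / ln x) = real (prime_count x) * ln x / x"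
      using eventually_gt_at_top[of 3]
    proof eventually_elim
      case (elim x)
      then have "real (N x) > 1" using N[of x] by linarith
      then have "ln (real (N x)) \<noteq> 0" "real (N x) \<noteq> 0" by auto
      then have "(c * ln (real (N x)) / real (N x)) * (real (N x) / x) / (ln (real (N x)) / ln x) = c * ln x / x" for c
        by simp
      then show ?case unfolding pc .
    qed
  qed
qed

section \<open>Counting SP numbers\<close>

text \<open>If \<open>p \<noteq> q\<close>, the multiplicity of \<open>p\<close> would be odd on the left and even on the right. So each SP number
  has a unique representation, and counting SP numbers is counting pairs.\<close>
lemma prime_times_square_eq_iff:
  fixes p q a b :: nat
  assumes "prime p" "prime q" "a > 0" "b > 0" "p * a\<^sup>2 = q * b\<^sup>2"
  shows "p = q \<and> a = b"
proof -
  have mult: "multiplicity r (r' * c\<^sup>2) = multiplicity r r' + 2 * multiplicity r c"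
    if "prime r" "prime r'" "c > 0" for r r' c :: nat
    using that by (subst prime_elem_multiplicity_mult_distrib)
      (auto simp: prime_elem_multiplicity_power_distrib prime_gt_0_nat)
  have "p = q"
  proof (rule ccontr)
    assume "p \<noteq> q"
    then have "multiplicity p q = 0" using assms by (simp add: prime_multiplicity_other)
    moreover have "multiplicity p p = 1" using assms by (simp add: multiplicity_prime)
    ultimately have "1 + 2 * multiplicity p a = 2 * multiplicity p b"
      using mult[of p p a] mult[of p q b] assms by simp
    then show False by presburger
  qed
  then show ?thesis using assms by (auto simp: prime_gt_0_nat power2_eq_iff_nonneg)
qed

definition SP_below :: "real \<Rightarrow> nat set" where
  "SP_below x = {m. SP_number m \<and> real m < x}"

lemma finite_SP_below [simp]: "finite (SP_below x)"
  by (rule finite_subset[of _ "{..nat \<lceil>x\<rceil>}"]) (auto simp: SP_below_def, linarith)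

lemma prime_count_eq_0: "x \<le> 1 \<Longrightarrow> prime_count x = 0"
  by (auto simp: prime_count_def dest: prime_gt_1_nat)

lemma prime_count_le: "real (prime_count x) \<le> max 0 x"
proof (cases "x \<le> 1")
  case False
  have "{p::nat. prime p \<and> real p < x} \<subseteq> {1..nat \<lfloor>x\<rfloor>}"
    using False by (auto simp: prime_ge_Suc_0_nat le_nat_iff le_floor_iff)
  then have "prime_count x \<le> card {1..nat \<lfloor>x\<rfloor>}"
    unfolding prime_count_def by (intro card_mono) auto
  then have "real (prime_count x) \<le> real (nat \<lfloor>x\<rfloor>)" by simp
  also have "\<dots> \<le> x" using False by (intro of_nat_floor) auto
  finally show ?thesis by simp
qed (simp add: prime_count_eq_0)

text \<open>The index \<open>k\<close> stands for the base \<open>a = k + 2\<close> of the square. Only finitely many terms are nonzero; the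
  sum is written as a series so that Tannery's theorem applies.\<close>
lemma card_SP_below:
  "(\<lambda>k. real (prime_count (x / (real (k + 2))\<^sup>2))) sums real (card (SP_below x))"
proof -
  define A where "A = nat \<lceil>x\<rceil>"
  have zero: "prime_count (x / (real (k + 2))\<^sup>2) = 0" if "k \<ge> A" for k
  proof (rule prime_count_eq_0)
    have "x \<le> real (k + 2)" using that unfolding A_def by linarith
    also have "\<dots> \<le> (real (k + 2))\<^sup>2" by (simp add: power2_eq_square)
    finally show "x / (real (k + 2))\<^sup>2 \<le> 1" by (simp add: divide_le_eq del: of_nat_add)
  qed
  define T where "T = (SIGMA k:{..<A}. {p::nat. prime p \<and> real p < x / (real (k + 2))\<^sup>2})"
  have iff: "real p < x / (real (k + 2))\<^sup>2 \<longleftrightarrow> real (p * (k + 2)\<^sup>2) < x" for p k :: nat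
    by (subst less_divide_eq) (simp_all del: of_nat_add)
  have "bij_betw (\<lambda>(k, p). p * (k + 2)\<^sup>2) T (SP_below x)"
  proof (rule bij_betwI')
    fix u v assume "u \<in> T" "v \<in> T"
    then show "((case u of (k, p) \<Rightarrow> p * (k + 2)\<^sup>2) = (case v of (k, p) \<Rightarrow> p * (k + 2)\<^sup>2)) = (u = v)"
      using prime_times_square_eq_iff[of "snd u" "snd v" "fst u + 2" "fst v + 2"]
      by (auto simp: T_def)
  next
    fix u assume u: "u \<in> T"
    obtain k p where [simp]: "u = (k, p)" by (cases u)
    have "prime p" "real (p * (k + 2)\<^sup>2) < x" using u iff[of p k] unfolding T_def by auto
    then show "(case u of (k, p) \<Rightarrow> p * (k + 2)\<^sup>2) \<in> SP_below x"
      unfolding SP_below_def SP_number_def by auto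
  next
    fix m assume "m \<in> SP_below x"
    then obtain p a where m: "real m < x" "prime p" "a \<ge> 2" "m = p * a\<^sup>2"
      unfolding SP_below_def SP_number_def by auto
    define k where "k = a - 2"
    have a: "a = k + 2" using m by (simp add: k_def)
    have "real p < x / (real (k + 2))\<^sup>2" unfolding iff using m a by simp
    moreover have "k < A"
    proof (rule ccontr)
      assume "\<not> k < A"
      then have "card {p::nat. prime p \<and> real p < x / (real (k + 2))\<^sup>2} = 0"
        using zero[of k] unfolding prime_count_def by simp
      then have "{p::nat. prime p \<and> real p < x / (real (k + 2))\<^sup>2} = {}"
        by (simp only: card_0_eq finite_primes_less)
      then show False using calculation m by blast
    qed
    ultimately have "(k, p) \<in> T" using m by (simp add: T_def)
    then show "\<exists>u\<in>T. m = (case u of (k, p) \<Rightarrow> p * (k + 2)\<^sup>2)"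
      using m a by (intro bexI[of _ "(k, p)"]) auto
  qed
  then have "card (SP_below x) = card T" by (simp add: bij_betw_same_card)
  also have "\<dots> = (\<Sum>k<A. prime_count (x / (real (k + 2))\<^sup>2))"
    unfolding T_def prime_count_def by (rule card_SigmaI) auto
  finally have eq: "real (card (SP_below x)) = (\<Sum>k<A. real (prime_count (x / (real (k + 2))\<^sup>2)))" by simp
  show ?thesis unfolding eq
    by (rule sums_finite) (use zero in auto)
qed

text \<open>A uniform form of the upper bound in the prime number theorem, for the majorant below.\<close>
lemma prime_count_ln_le:
  obtains C where "C \<ge> 0" "\<And>y. y \<ge> 1 \<Longrightarrow> real (prime_count y) * ln y \<le> C * y"
proof -
  have "\<forall>\<^sub>F y in at_top. real (prime_count y) * ln y / y < 2"
    using prime_count_asymptotics by (rule order_tendstoD) simp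
  then obtain Y where Y: "\<And>y. y \<ge> Y \<Longrightarrow> real (prime_count y) * ln y / y < 2"
    by (auto simp: eventually_at_top_linorder)
  define C where "C = max 2 (ln (max 1 Y))"
  show thesis
  proof (rule that[of C])
    fix y :: real assume y: "y \<ge> 1"
    show "real (prime_count y) * ln y \<le> C * y"
    proof (cases "y \<ge> Y")
      case True
      have "real (prime_count y) * ln y \<le> 2 * y" using Y[OF True] y by (simp add: divide_less_eq)
      also have "\<dots> \<le> C * y" using y by (intro mult_right_mono) (auto simp: C_def)
      finally show ?thesis .
    next
      case False
      have "ln y \<le> ln (max 1 Y)" using False y by (intro ln_mono) auto
      then have "ln y \<le> C" by (simp add: C_def)
      then have "real (prime_count y) * ln y \<le> y * C"
        using prime_count_le[of y] y by (intro mult_mono) auto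
      then show ?thesis by (simp add: mult.commute)
    qed
  qed (auto simp: C_def)
qed

text \<open>Divided by \<open>x / ln x\<close>, the term of the series \<open>card_SP_below\<close> that belongs to the base \<open>a\<close> tends to
  \<open>1 / a^2\<close> by the prime number theorem. Tannery's theorem permits the interchange with the sum:
  for \<open>y = x / a^2 \<ge> 1\<close> write \<open>ln x = ln y + 2 * ln a\<close>, and then \<open>prime_count y * ln x\<close> is at most
  \<open>(C + 2 * ln a) * y\<close>, which is summable over \<open>a\<close> after division by \<open>x\<close>. The constant is
  \<open>\<kappa> = (\<Sum>a\<ge>2. 1 / a^2)\<close>, and its positivity lets it cancel in ratios.\<close>
theorem SP_below_asymptotics:
  obtains \<kappa> :: real where "\<kappa> > 0" "((\<lambda>x. real (card (SP_below x)) * ln x / x) \<longlongrightarrow> \<kappa>) at_top"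
proof -
  define a where "a k x = real (prime_count (x / (real (k + 2))\<^sup>2)) * ln x / x" for k x
  define b where "b k = 1 / (real (k + 2))\<^sup>2" for k
  obtain C where C: "C \<ge> 0" "\<And>y. y \<ge> 1 \<Longrightarrow> real (prime_count y) * ln y \<le> C * y"
    by (rule prime_count_ln_le) blast
  define M where "M k = C * real (k + 2) powr (-2) + 4 * real (k + 2) powr (-3/2)" for k
  have sumeq: "(\<lambda>k. a k x) sums (real (card (SP_below x)) * ln x / x)" for x
    unfolding a_def by (intro sums_divide sums_mult2 card_SP_below)
  have limit: "((\<lambda>x. a k x) \<longlongrightarrow> b k) at_top" for k
  proof -
    define q where "q = (real (k + 2))\<^sup>2"
    have q: "q > 0" by (simp add: q_def)
    have top: "filterlim (\<lambda>x. x / q) at_top at_top" using q by real_asymp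
    have 1: "((\<lambda>x. real (prime_count (x / q)) * ln (x / q) / (x / q)) \<longlongrightarrow> 1) at_top"
      by (rule filterlim_compose[OF prime_count_asymptotics top])
    have 2: "((\<lambda>x. ln x / ln (x / q)) \<longlongrightarrow> 1) at_top" using q by real_asymp
    have "((\<lambda>x. (real (prime_count (x / q)) * ln (x / q) / (x / q)) * (ln x / ln (x / q)) / q) \<longlongrightarrow> 1 * 1 / q) at_top"
      using q by (intro tendsto_intros 1 2) auto
    moreover have "\<forall>\<^sub>F x in at_top. (real (prime_count (x / q)) * ln (x / q) / (x / q)) * (ln x / ln (x / q)) / q
        = a k x"
      using eventually_gt_at_top[of q]
    proof eventually_elim
      case (elim x)
      then have "x / q > 1" using q by simp
      then have "ln (x / q) \<noteq> 0" "x \<noteq> 0" using q by auto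
      then have "(c * ln (x / q) / (x / q)) * (ln x / ln (x / q)) / q = c * ln x / x" for c
        using q by simp
      then show ?case unfolding a_def q_def[symmetric] .
    qed
    ultimately show ?thesis unfolding b_def q_def[symmetric]
      using Lim_transform_eventually by fastforce
  qed
  have neg2: "real (k + 2) powr (-2) = 1 / (real (k + 2))\<^sup>2" for k
    by (rule powr_neg_numeral) simp
  have bound: "norm (a k x) \<le> M k" if x: "x \<ge> 1" for k x
  proof -
    define y where "y = x / (real (k + 2))\<^sup>2"
    have xy: "x = y * (real (k + 2))\<^sup>2" by (simp add: y_def)
    have M0: "M k \<ge> 0" using C by (simp add: M_def)
    show ?thesis
    proof (cases "y \<ge> 1")
      case False
      then have "a k x = 0" unfolding a_def y_def[symmetric] by (simp add: prime_count_eq_0)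
      then show ?thesis using M0 by simp
    next
      case True
      have lnx: "ln x = ln y + 2 * ln (real (k + 2))"
        unfolding xy using True by (simp add: ln_mult ln_realpow)
      have "ln (real (k + 2)) \<le> real (k + 2) powr (1/2) / (1/2)"
        by (rule ln_powr_bound) auto
      then have lnk: "ln (real (k + 2)) \<le> 2 * real (k + 2) powr (1/2)" by simp
      have "real (prime_count y) * ln x = real (prime_count y) * ln y + real (prime_count y) * (2 * ln (real (k + 2)))"
        unfolding lnx by (rule distrib_left)
      also have "\<dots> \<le> C * y + y * (2 * (2 * real (k + 2) powr (1/2)))"
        using prime_count_le[of y] True
        by (intro add_mono mult_mono C mult_left_mono lnk) auto
      also have "\<dots> = (C + 4 * real (k + 2) powr (1/2)) * y" by (simp add: algebra_simps)
      finally have "real (prime_count y) * ln x / x \<le> (C + 4 * real (k + 2) powr (1/2)) * y / x"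
        using x by (intro divide_right_mono) auto
      also have "(C + 4 * real (k + 2) powr (1/2)) * y / x = (C + 4 * real (k + 2) powr (1/2)) / (real (k + 2))\<^sup>2"
        unfolding xy using True by simp
      also have "\<dots> = (C + 4 * real (k + 2) powr (1/2)) * real (k + 2) powr (-2)"
        unfolding neg2 by simp
      also have "\<dots> = C * real (k + 2) powr (-2) + 4 * (real (k + 2) powr (1/2) * real (k + 2) powr (-2))"
        by (simp only: distrib_right mult.assoc)
      also have "real (k + 2) powr (1/2) * real (k + 2) powr (-2) = real (k + 2) powr (-3/2)"
        unfolding powr_add[symmetric] by simp
      finally have "a k x \<le> M k" unfolding a_def y_def M_def .
      moreover have "a k x \<ge> 0" using x by (simp add: a_def)
      ultimately show ?thesis by simp
    qed
  qed
  have sM: "summable M"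
  proof -
    have s: "summable (\<lambda>k. real (k + 2) powr e)" if "e < -1" for e
      using summable_real_powr_iff[of e] that summable_iff_shift[of "\<lambda>k. real k powr e" 2] by simp
    show ?thesis unfolding M_def by (intro summable_add summable_mult s) auto
  qed
  have sb: "summable b"
  proof (rule summable_comparison_test_ev)
    show "summable (\<lambda>k. real (k + 2) powr (-2))"
      using summable_real_powr_iff[of "-2"] summable_iff_shift[of "\<lambda>k. real k powr (-2)" 2] by simp
    show "\<forall>\<^sub>F k in sequentially. norm (b k) \<le> real (k + 2) powr (-2)"
      unfolding neg2 by (simp add: b_def)
  qed
  have "((\<lambda>x. suminf (\<lambda>k. a k x)) \<longlongrightarrow> suminf b) at_top"
  proof -
    have "\<forall>\<^sub>F (k, x) in sequentially \<times>\<^sub>F at_top. norm (a k x) \<le> M k"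
      unfolding case_prod_unfold
      by (rule eventually_mono[OF eventually_prodI[OF always_eventually eventually_ge_at_top[of 1]]])
         (use bound in auto)
    from tannerys_theorem[OF limit this sM] show ?thesis by simp
  qed
  moreover have "suminf (\<lambda>k. a k x) = real (card (SP_below x)) * ln x / x" for x
    using sumeq[of x] by (simp add: sums_iff)
  ultimately have "((\<lambda>x. real (card (SP_below x)) * ln x / x) \<longlongrightarrow> suminf b) at_top" by simp
  moreover have "suminf b > 0" by (rule suminf_pos[OF sb]) (simp add: b_def)
  ultimately show thesis using that by blast
qed

text \<open>Regular variation of index 1: the factor \<open>x / ln x\<close> gains exactly \<open>c\<close> in the limit when \<open>x\<close> is scaled
  by \<open>c\<close>, and \<open>\<kappa>\<close> cancels.\<close>
theorem SP_below_ratio: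
  assumes c: "0 \<le> c"
  shows "(\<lambda>j. real (card (SP_below (c * real j))) / real (card (SP_below (real j)))) \<longlonglongrightarrow> c"
proof (cases "c = 0")
  case True
  then show ?thesis by (simp add: SP_below_def)
next
  case False
  then have c: "c > 0" using assms by simp
  obtain \<kappa> :: real where k: "\<kappa> > 0" and lim: "((\<lambda>x. real (card (SP_below x)) * ln x / x) \<longlongrightarrow> \<kappa>) at_top"
    by (rule SP_below_asymptotics)
  have 1: "(\<lambda>j. real (card (SP_below (c * real j))) * ln (c * real j) / (c * real j)) \<longlonglongrightarrow> \<kappa>"
    by (rule filterlim_compose[OF lim]) (use c in real_asymp)
  have 2: "(\<lambda>j. real (card (SP_below (real j))) * ln (real j) / real j) \<longlonglongrightarrow> \<kappa>"
    by (rule filterlim_compose[OF lim filterlim_real_sequentially])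
  have 3: "(\<lambda>j. c * (ln (real j) / ln (c * real j))) \<longlonglongrightarrow> c" using c by real_asymp
  have "(\<lambda>j. (real (card (SP_below (c * real j))) * ln (c * real j) / (c * real j)) / (real (card (SP_below (real j))) * ln (real j) / real j)
       * (c * (ln (real j) / ln (c * real j)))) \<longlonglongrightarrow> \<kappa> / \<kappa> * c"
    using k by (intro tendsto_intros 1 2 3) auto
  then have *: "(\<lambda>j. (real (card (SP_below (c * real j))) * ln (c * real j) / (c * real j)) / (real (card (SP_below (real j))) * ln (real j) / real j)
       * (c * (ln (real j) / ln (c * real j)))) \<longlonglongrightarrow> c" using k by simp
  show ?thesis
  proof (rule Lim_transform_eventually[OF *])
    have "\<forall>\<^sub>F j in sequentially. c * real j > 1" using c by real_asymp
    then show "\<forall>\<^sub>F j in sequentially. (real (card (SP_below (c * real j))) * ln (c * real j) / (c * real j)) / (real (card (SP_below (real j))) * ln (real j) / real j)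
       * (c * (ln (real j) / ln (c * real j))) = real (card (SP_below (c * real j))) / real (card (SP_below (real j)))"
      using eventually_gt_at_top[of 1]
    proof eventually_elim
      case (elim j)
      then have "ln (c * real j) > 0" "ln (real j) > 0" "real j > 0" by (auto simp del: ln_gt_zero_iff intro: ln_gt_zero)
      moreover have "(u * l / (c * r)) / (v * m / r) * (c * (m / l)) = u / v"
        if "l > 0" "m > 0" "r > 0" for u v l m r :: real
        using that c by (simp add: field_simps)
      ultimately show ?case by blast
    qed
  qed
qed

lemma SP_below_tendsto: "filterlim (\<lambda>j. real (card (SP_below (real j)))) at_top sequentially"
proof -
  obtain \<kappa> :: real where k: "\<kappa> > 0" and lim: "((\<lambda>x. real (card (SP_below x)) * ln x / x) \<longlongrightarrow> \<kappa>) at_top"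
    by (rule SP_below_asymptotics)
  have 1: "filterlim (\<lambda>j. (real (card (SP_below (real j))) * ln (real j) / real j) * (real j / ln (real j))) at_top sequentially"
    by (rule filterlim_tendsto_pos_mult_at_top[OF filterlim_compose[OF lim filterlim_real_sequentially] k]) real_asymp
  show ?thesis
    by (rule filterlim_mono_eventually[OF 1 order_refl order_refl])
       (rule eventually_mono[OF eventually_gt_at_top[of 1]], auto)
qed

lemma infinite_SP: "infinite {m. SP_number m}"
proof
  assume fin: "finite {m. SP_number m}"
  have "card (SP_below (real j)) \<le> card {m. SP_number m}" for j
    using fin by (intro card_mono) (auto simp: SP_below_def)
  moreover have "\<forall>\<^sub>F j in sequentially. real (card {m. SP_number m}) < real (card (SP_below (real j)))"
    using SP_below_tendsto unfolding filterlim_at_top_dense by blast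
  ultimately show False by (auto simp: eventually_sequentially not_less[symmetric])
qed

lemma sp_eq_enumerate: "sp = enumerate {m. SP_number m}"
  by (simp add: fun_eq_iff sp_def)

lemma strict_mono_sp: "strict_mono sp"
  unfolding sp_eq_enumerate by (rule strict_mono_enumerate[OF infinite_SP])

lemma range_sp: "range sp = {m. SP_number m}"
  unfolding sp_eq_enumerate by (rule range_enumerate[OF infinite_SP])

lemma sp_less_iff: "sp k < j \<longleftrightarrow> k < SP_count j"
proof -
  have le: "sp i \<le> sp k" if "i \<le> k" for i k
    using strict_mono_less_eq[OF strict_mono_sp] that by simp
  have img: "{m. SP_number m \<and> m < j} = sp ` {k. sp k < j}"
    using range_sp by auto
  have count: "SP_count j = card {k. sp k < j}"
    unfolding SP_count_def img
    by (rule card_image) (rule inj_on_subset[OF strict_mono_imp_inj_on[OF strict_mono_sp] subset_UNIV])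
  have fin: "finite {k. sp k < j}"
  proof (rule finite_subset[of _ "{..<j}"])
    show "{k. sp k < j} \<subseteq> {..<j}"
      using strict_mono_imp_increasing[OF strict_mono_sp] le_less_trans by blast
  qed simp
  show ?thesis
  proof
    assume "sp k < j"
    then have "{..k} \<subseteq> {k. sp k < j}" using le le_less_trans by blast
    then have "card {..k} \<le> SP_count j" unfolding count by (rule card_mono[OF fin])
    then show "k < SP_count j" by simp
  next
    assume k: "k < SP_count j"
    show "sp k < j"
    proof (rule ccontr)
      assume nk: "\<not> sp k < j"
      have "{k. sp k < j} \<subseteq> {..<k}"
      proof
        fix i assume "i \<in> {k. sp k < j}"
        then show "i \<in> {..<k}" using le[of k i] nk by (cases "k \<le> i") auto
      qed
      then have "card {k. sp k < j} \<le> card {..<k}" by (intro card_mono) auto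
      then show False using k count by simp
    qed
  qed
qed

text \<open>The bound \<open>k < SP_count j\<close> in the definition of the fractions is implied by \<open>sp k < \<beta> * j\<close>, since \<open>\<beta> \<le> 1\<close>.\<close>
lemma length_filter_SP_fractions:
  assumes "0 \<le> \<alpha>" "\<alpha> < \<beta>" "\<beta> \<le> 1" "j > 0"
  shows "length (filter (\<lambda>u. u \<in> {\<alpha><..<\<beta>}) (SP_fractions j)) = card {m\<in>SP_below (\<beta> * real j). real m > \<alpha> * real j}"
proof -
  have "length (filter (\<lambda>u. u \<in> {\<alpha><..<\<beta>}) (SP_fractions j)) =
      card {k. k < SP_count j \<and> real (sp k) / real j \<in> {\<alpha><..<\<beta>}}"
    unfolding SP_fractions_def filter_map length_map length_filter_conv_card by (auto intro!: arg_cong[where f = card])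
  also have "{k. k < SP_count j \<and> real (sp k) / real j \<in> {\<alpha><..<\<beta>}} = {k. \<alpha> * real j < real (sp k) \<and> real (sp k) < \<beta> * real j}"
  proof (intro Collect_cong)
    fix k
    have "\<beta> * real j \<le> real j" using assms mult_right_mono[of \<beta> 1 "real j"] by simp
    then have "sp k < j" if "real (sp k) < \<beta> * real j"
      using that of_nat_less_iff[of "sp k" j, where ?'a = real] by linarith
    then show "(k < SP_count j \<and> real (sp k) / real j \<in> {\<alpha><..<\<beta>}) = (\<alpha> * real j < real (sp k) \<and> real (sp k) < \<beta> * real j)"
      unfolding sp_less_iff[symmetric] using assms by (auto simp: less_divide_eq divide_less_eq)
  qed
  also have "card \<dots> = card (sp ` \<dots>)"
    by (rule card_image[symmetric], rule inj_on_subset[OF strict_mono_imp_inj_on[OF strict_mono_sp] subset_UNIV])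
  also have "sp ` {k. \<alpha> * real j < real (sp k) \<and> real (sp k) < \<beta> * real j} = {m\<in>SP_below (\<beta> * real j). real m > \<alpha> * real j}"
    using range_sp unfolding SP_below_def by auto
  finally show ?thesis .
qed

theorem theorem2p1:
  shows "uniformly_distributed SP_fractions"
  unfolding uniformly_distributed_def
proof (intro allI impI)
  fix \<alpha> \<beta> :: real assume ab: "0 \<le> \<alpha> \<and> \<alpha> \<le> \<beta> \<and> \<beta> \<le> 1"
  have len: "length (SP_fractions j) = card (SP_below (real j))" for j
    by (simp add: SP_fractions_def SP_count_def SP_below_def)
  show "(\<lambda>j. real (length (filter (\<lambda>u. u \<in> {\<alpha><..<\<beta>}) (SP_fractions j))) / real (length (SP_fractions j))) \<longlonglongrightarrow> \<beta> - \<alpha>"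
  proof (cases "\<alpha> = \<beta>")
    case True
    then show ?thesis by simp
  next
    case False
    then have lt: "\<alpha> < \<beta>" using ab by simp
    let ?S = "\<lambda>j. real (card (SP_below (real j)))"
    define f where "f j = real (length (filter (\<lambda>u. u \<in> {\<alpha><..<\<beta>}) (SP_fractions j)))" for j
    define g where "g j = real (card (SP_below (\<beta> * real j))) - real (card (SP_below (\<alpha> * real j)))" for j
    \<comment> \<open>The counting function is strict, so \<open>g\<close> may include the one value \<open>\<alpha> * j\<close>, which the open interval omits.\<close>
    have fg: "g j - 1 \<le> f j \<and> f j \<le> g j" if j: "j > 0" for j
    proof -
      let ?A = "SP_below (\<alpha> * real j)" and ?B = "SP_below (\<beta> * real j)" and ?E = "{m. real m = \<alpha> * real j}"
      have sub: "?A \<subseteq> ?B" using lt mult_right_mono[of \<alpha> \<beta> "real j"] by (auto simp: SP_below_def)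
      have f: "f j = real (card {m\<in>?B. real m > \<alpha> * real j})"
        using length_filter_SP_fractions[of \<alpha> \<beta> j] ab lt j by (simp add: f_def)
      have d: "real (card (?B - ?A)) = g j"
        using sub card_mono[OF finite_SP_below sub] by (simp add: card_Diff_subset g_def of_nat_diff)
      have "?E \<subseteq> {nat \<lfloor>\<alpha> * real j\<rfloor>}" by (auto, metis floor_of_nat nat_int)
      then have E: "finite ?E" "card ?E \<le> 1" using finite_subset card_mono[of "{nat \<lfloor>\<alpha> * real j\<rfloor>}" ?E] by auto
      have "?B - ?A \<subseteq> {m\<in>?B. real m > \<alpha> * real j} \<union> ?E" by (auto simp: SP_below_def)
      then have "card (?B - ?A) \<le> card ({m\<in>?B. real m > \<alpha> * real j} \<union> ?E)"
        using E by (intro card_mono) auto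
      also have "\<dots> \<le> card {m\<in>?B. real m > \<alpha> * real j} + card ?E" by (rule card_Un_le)
      finally have "g j \<le> f j + 1" using E d f by linarith
      moreover have "card {m\<in>?B. real m > \<alpha> * real j} \<le> card (?B - ?A)"
        by (intro card_mono finite_Diff finite_SP_below) (auto simp: SP_below_def)
      ultimately show ?thesis using d f by linarith
    qed
    have limg: "(\<lambda>j. g j / ?S j) \<longlonglongrightarrow> \<beta> - \<alpha>"
      unfolding g_def diff_divide_distrib by (intro tendsto_intros SP_below_ratio) (use ab in auto)
    have "(\<lambda>j. f j / ?S j) \<longlonglongrightarrow> \<beta> - \<alpha>"
    proof (rule tendsto_sandwich)
      show "\<forall>\<^sub>F j in sequentially. (g j - 1) / ?S j \<le> f j / ?S j"
        using eventually_gt_at_top[of 0] by eventually_elim (auto intro!: divide_right_mono dest: fg)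
      show "\<forall>\<^sub>F j in sequentially. f j / ?S j \<le> g j / ?S j"
        using eventually_gt_at_top[of 0] by eventually_elim (auto intro!: divide_right_mono dest: fg)
      have "(\<lambda>j. g j / ?S j - 1 / ?S j) \<longlonglongrightarrow> \<beta> - \<alpha> - 0"
        by (intro tendsto_diff limg tendsto_divide_0[OF tendsto_const] filterlim_at_top_imp_at_infinity SP_below_tendsto)
      then show "(\<lambda>j. (g j - 1) / ?S j) \<longlonglongrightarrow> \<beta> - \<alpha>" by (simp add: diff_divide_distrib)
    qed (rule limg)
    then show ?thesis unfolding len f_def .
  qed
qed

end
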